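(* Let $G=(V,E)$ be a finite undirected graph with real edge weights $\{w_e\}_{e\in E}$, and let $\mathcal C$ be a collection of odd-length cycles of $G$ that are pairwise edge-disjoint. Consider the linear program $$\text{C-LP}:\quad \max \sum_{e\in E} w_e x_e \ \text{ s.t. } \sum_{e\in\delta(i)} x_e\le 1\ \ \forall i\in V,\quad \sum_{e\in E(C)} x_e\le \tfrac{|C|-1}{2}\ \ \forall C\in\mathcal C,\quad x_e\in[0,1]\ \ \forall e\in E.$$ Suppose C-LP has a unique optimal solution and this solution is integral. Run max-product belief propagation on the graphical model on $y\in\{0,1\}^{E'}$ defined in the context below. Then the BP estimate $y^{\mathrm{BP}}(t)$ converges (i.e. is equal for all sufficiently large $t$) to the MAP assignment $y^*$ of that graphical model. Moreover, the maximum weight matching $x^*\in\{0,1\}^E$ of $G$ is obtained from $y^*$ by $$x^*_e=\begin{cases}\frac12\sum_{j\in V(C)}(-1)^{d_C(j,e)}\,y^*_{(i_C,j)} & \text{if } e\in E(C) \text{ for some } C\in\mathcal C,\\ y^*_e & \text{otherwise.}\end{cases}$$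
   Context: Notation: $\delta(i)$ is the set of edges incident to vertex $i$ (in whichever graph is under discussion). For a cycle $C=(j_1,\dots,j_k)$, $V(C)$ is its vertex set, $|C|=k$ its length, and $E(C)$ its edge set; for a vertex $j\in V(C)$ and an edge $e\in E(C)$, $d_C(j,e)$ is the graph distance in the cycle $C$ between $j$ and the edge $e$ (distance from $j$ to the nearer endpoint of $e$; e.g. if $e=(j_2,j_3)$ then $d_C(j_1,e)=1$ and $d_C(j_2,e)=0$). A matching is a set of edges with no common vertices; a maximum weight matching maximizes the total edge weight. Transformed graph: $G'=(V',E')$ with $V'=V\cup\{i_C: C\in\mathcal C\}$ (one new vertex per cycle) and $E'=\big(E\setminus\bigcup_{C\in\mathcal C}E(C)\big)\cup\{(i_C,j): j\in V(C),\,C\in\mathcal C\}$. Weights: $w'_{(i_C,j)}=\frac12\sum_{e'\in E(C)}(-1)^{d_C(j,e')}w_{e'}$ for the new edges, and $w'_e=w_e$ for all other edges of $E'$. Graphical model: for $y=[y_e]\in\{0,1\}^{E'}$, $\Pr[Y=y]\propto\prod_{e\in E'}e^{w'_e y_e}\prod_{i\in V}\psi_i(y)\prod_{C\in\mathcal C}\psi_C(y)$, where $\psi_i(y)=1$ if $\sum_{e\in\delta(i)}y_e\le1$ (with $\delta(i)$ taken in $G'$) and $0$ otherwise; and $\psi_C(y)=0$ if $\sum_{e\in\delta(i_C)}y_e>|C|-1$, or if $\sum_{j\in V(C)}(-1)^{d_C(j,e)}y_{(i_C,j)}\notin\{0,2\}$ for some $e\in E(C)$; and $\psi_C(y)=1$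 otherwise. The MAP assignment $y^*$ is the maximizer of this distribution. Max-product BP: the factors are the $\psi_i$ ($i\in V$, involving variables $y_e$, $e\in\delta(i)$) and the $\psi_C$ ($C\in\mathcal C$, involving $y_e$, $e\in\delta(i_C)$); the variable function of $y_e$ is $e^{w'_e y_e}$. Messages between each variable $e$ and each factor $\alpha$ containing it are initialized to $1$ and updated by $m^{t+1}_{\alpha\to e}(z)=\max_{y':y'_e=z}\psi_\alpha(y')\prod_{f\in\alpha\setminus e}m^t_{f\to\alpha}(y'_f)$ and $m^{t+1}_{e\to\alpha}(z)=e^{w'_e z}\prod_{\alpha'\ni e,\alpha'\ne\alpha}m^t_{\alpha'\to e}(z)$. The belief is $n^t_e(z)=e^{w'_e z}\prod_{\alpha\ni e}m^t_{\alpha\to e}(z)$, and the BP estimate is $y^{\mathrm{BP}}_e(t)=1$ if $n^t_e(1)>n^t_e(0)$, $0$ if $n^t_e(1)<n^t_e(0)$, and "?" if equal. *)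

theory Defs
  imports Complex_Main
begin

definition finite_graph :: "'v set \<Rightarrow> 'v set set \<Rightarrow> bool" where
  "finite_graph V E \<longleftrightarrow> finite V \<and> (\<forall>e\<in>E. e \<subseteq> V \<and> card e = 2)"

definition cyc_edges :: "'v list \<Rightarrow> 'v set set" where
  "cyc_edges C = {{C ! i, C ! (Suc i mod length C)} | i. i < length C}"

definition is_cycle :: "'v set \<Rightarrow> 'v set set \<Rightarrow> 'v list \<Rightarrow> bool" where
  "is_cycle V E C \<longleftrightarrow> 3 \<le> length C \<and> distinct C \<and> set C \<subseteq> V \<and> cyc_edges C \<subseteq> E"

definition odd_cycle_collection :: "'v set \<Rightarrow> 'v set set \<Rightarrow> 'v list set \<Rightarrow> bool" where
  "odd_cycle_collection V E Cs \<longleftrightarrow> finite Cs \<and>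
     (\<forall>C\<in>Cs. is_cycle V E C \<and> odd (length C)) \<and>
     (\<forall>C\<in>Cs. \<forall>C'\<in>Cs. C \<noteq> C' \<longrightarrow> cyc_edges C \<inter> cyc_edges C' = {})"

definition cyc_pos :: "'v list \<Rightarrow> 'v \<Rightarrow> nat" where
  "cyc_pos C u = (LEAST i. i < length C \<and> C ! i = u)"

definition cyc_vdist :: "'v list \<Rightarrow> 'v \<Rightarrow> 'v \<Rightarrow> nat" where
  "cyc_vdist C u v =
     (let a = cyc_pos C u; b = cyc_pos C v;
          d = (if a \<le> b then b - a else a - b)
      in min d (length C - d))"

definition cyc_dist :: "'v list \<Rightarrow> 'v \<Rightarrow> 'v set \<Rightarrow> nat" where
  "cyc_dist C j e = Min ((\<lambda>u. cyc_vdist C j u) ` e)"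

definition is_matching :: "'v set set \<Rightarrow> 'v set set \<Rightarrow> bool" where
  "is_matching E M \<longleftrightarrow> M \<subseteq> E \<and> (\<forall>e1\<in>M. \<forall>e2\<in>M. e1 \<noteq> e2 \<longrightarrow> e1 \<inter> e2 = {})"

definition is_max_weight_matching :: "'v set set \<Rightarrow> ('v set \<Rightarrow> real) \<Rightarrow> 'v set set \<Rightarrow> bool" where
  "is_max_weight_matching E w M \<longleftrightarrow>
     is_matching E M \<and> (\<forall>M'. is_matching E M' \<longrightarrow> sum w M' \<le> sum w M)"

definition clp_feasible :: "'v set \<Rightarrow> 'v set set \<Rightarrow> 'v list set \<Rightarrow> ('v set \<Rightarrow> real) \<Rightarrow> bool" where
  "clp_feasible V E Cs x \<longleftrightarrow>
     (\<forall>i\<in>V. (\<Sum>e\<in>{e\<in>E. i \<in> e}. x e) \<le> 1) \<and>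
     (\<forall>C\<in>Cs. (\<Sum>e\<in>cyc_edges C. x e) \<le> (real (length C) - 1) / 2) \<and>
     (\<forall>e\<in>E. 0 \<le> x e \<and> x e \<le> 1)"

definition clp_optimal :: "'v set \<Rightarrow> 'v set set \<Rightarrow> 'v list set \<Rightarrow> ('v set \<Rightarrow> real) \<Rightarrow> ('v set \<Rightarrow> real) \<Rightarrow> bool" where
  "clp_optimal V E Cs w x \<longleftrightarrow> clp_feasible V E Cs x \<and>
     (\<forall>x'. clp_feasible V E Cs x' \<longrightarrow> (\<Sum>e\<in>E. w e * x' e) \<le> (\<Sum>e\<in>E. w e * x e))"

text \<open>C-LP has a unique optimal solution (solutions are determined by their values on E),
  and it is integral.\<close>
definition clp_unique_integral_opt :: "'v set \<Rightarrow> 'v set set \<Rightarrow> 'v list set \<Rightarrow> ('v set \<Rightarrow> real) \<Rightarrow> bool" where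
  "clp_unique_integral_opt V E Cs w \<longleftrightarrow>
     (\<exists>x. clp_optimal V E Cs w x \<and>
          (\<forall>x'. clp_optimal V E Cs w x' \<longrightarrow> (\<forall>e\<in>E. x' e = x e)) \<and>
          (\<forall>e\<in>E. x e \<in> {0, 1}))"

text \<open>Edges of G': old edges (OldE e) and new edges (i_C, j) written NewE C j.\<close>
datatype 'v edge' = OldE "'v set" | NewE "'v list" 'v

definition cyc_union :: "'v list set \<Rightarrow> 'v set set" where
  "cyc_union Cs = \<Union> (cyc_edges ` Cs)"

definition E' :: "'v set set \<Rightarrow> 'v list set \<Rightarrow> 'v edge' set" where
  "E' E Cs = OldE ` (E - cyc_union Cs) \<union> {NewE C j | C j. C \<in> Cs \<and> j \<in> set C}"

definition delta_v :: "'v set set \<Rightarrow> 'v list set \<Rightarrow> 'v \<Rightarrow> 'v edge' set" where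
  "delta_v E Cs i = OldE ` {e \<in> E - cyc_union Cs. i \<in> e} \<union> {NewE C i | C. C \<in> Cs \<and> i \<in> set C}"

definition delta_c :: "'v list \<Rightarrow> 'v edge' set" where
  "delta_c C = NewE C ` set C"

definition w' :: "('v set \<Rightarrow> real) \<Rightarrow> 'v edge' \<Rightarrow> real" where
  "w' w f = (case f of OldE e \<Rightarrow> w e
     | NewE C j \<Rightarrow> 1/2 * (\<Sum>e'\<in>cyc_edges C. (-1) ^ (cyc_dist C j e') * w e'))"

definition ind :: "bool \<Rightarrow> real" where
  "ind b = (if b then 1 else 0)"

definition psi_v :: "'v set set \<Rightarrow> 'v list set \<Rightarrow> 'v \<Rightarrow> ('v edge' \<Rightarrow> bool) \<Rightarrow> real" where
  "psi_v E Cs i y = (if (\<Sum>f\<in>delta_v E Cs i. ind (y f)) \<le> 1 then 1 else 0)"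

definition psi_c :: "'v list \<Rightarrow> ('v edge' \<Rightarrow> bool) \<Rightarrow> real" where
  "psi_c C y =
     (if (\<Sum>f\<in>delta_c C. ind (y f)) > real (length C) - 1 \<or>
         (\<exists>e\<in>cyc_edges C. (\<Sum>j\<in>set C. (-1) ^ (cyc_dist C j e) * ind (y (NewE C j))) \<notin> {0, 2})
      then 0 else 1)"

definition assignments :: "'v set set \<Rightarrow> 'v list set \<Rightarrow> ('v edge' \<Rightarrow> bool) set" where
  "assignments E Cs = {y. \<forall>f. f \<notin> E' E Cs \<longrightarrow> \<not> y f}"

definition gm_weight :: "'v set \<Rightarrow> 'v set set \<Rightarrow> 'v list set \<Rightarrow> ('v set \<Rightarrow> real) \<Rightarrow> ('v edge' \<Rightarrow> bool) \<Rightarrow> real" where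
  "gm_weight V E Cs w y =
     (\<Prod>f\<in>E' E Cs. exp (w' w f * ind (y f))) * (\<Prod>i\<in>V. psi_v E Cs i y) * (\<Prod>C\<in>Cs. psi_c C y)"

definition gm_prob :: "'v set \<Rightarrow> 'v set set \<Rightarrow> 'v list set \<Rightarrow> ('v set \<Rightarrow> real) \<Rightarrow> ('v edge' \<Rightarrow> bool) \<Rightarrow> real" where
  "gm_prob V E Cs w y = gm_weight V E Cs w y / (\<Sum>y'\<in>assignments E Cs. gm_weight V E Cs w y')"

definition is_MAP :: "'v set \<Rightarrow> 'v set set \<Rightarrow> 'v list set \<Rightarrow> ('v set \<Rightarrow> real) \<Rightarrow> ('v edge' \<Rightarrow> bool) \<Rightarrow> bool" where
  "is_MAP V E Cs w y \<longleftrightarrow> y \<in> assignments E Cs \<and>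
     (\<forall>y'\<in>assignments E Cs. gm_prob V E Cs w y' \<le> gm_prob V E Cs w y)"

datatype 'v fac = FV 'v | FC "'v list"

definition factors :: "'v set \<Rightarrow> 'v list set \<Rightarrow> 'v fac set" where
  "factors V Cs = FV ` V \<union> FC ` Cs"

definition fvars :: "'v set set \<Rightarrow> 'v list set \<Rightarrow> 'v fac \<Rightarrow> 'v edge' set" where
  "fvars E Cs \<alpha> = (case \<alpha> of FV i \<Rightarrow> delta_v E Cs i | FC C \<Rightarrow> delta_c C)"

definition psi_fac :: "'v set set \<Rightarrow> 'v list set \<Rightarrow> 'v fac \<Rightarrow> ('v edge' \<Rightarrow> bool) \<Rightarrow> real" where
  "psi_fac E Cs \<alpha> y = (case \<alpha> of FV i \<Rightarrow> psi_v E Cs i y | FC C \<Rightarrow> psi_c C y)"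

definition local_configs :: "'v set set \<Rightarrow> 'v list set \<Rightarrow> 'v fac \<Rightarrow> 'v edge' \<Rightarrow> bool \<Rightarrow> ('v edge' \<Rightarrow> bool) set" where
  "local_configs E Cs \<alpha> e z = {y. (\<forall>f. f \<notin> fvars E Cs \<alpha> \<longrightarrow> \<not> y f) \<and> y e = z}"

primrec bp_msgs :: "'v set \<Rightarrow> 'v set set \<Rightarrow> 'v list set \<Rightarrow> ('v set \<Rightarrow> real) \<Rightarrow> nat \<Rightarrow>
    ('v fac \<Rightarrow> 'v edge' \<Rightarrow> bool \<Rightarrow> real) \<times> ('v edge' \<Rightarrow> 'v fac \<Rightarrow> bool \<Rightarrow> real)" where
  "bp_msgs V E Cs w 0 = ((\<lambda>\<alpha> e z. 1), (\<lambda>e \<alpha> z. 1))"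
| "bp_msgs V E Cs w (Suc t) =
     ((\<lambda>\<alpha> e z. Max ((\<lambda>y. psi_fac E Cs \<alpha> y *
                           (\<Prod>f\<in>fvars E Cs \<alpha> - {e}. snd (bp_msgs V E Cs w t) f \<alpha> (y f)))
                      ` local_configs E Cs \<alpha> e z)),
      (\<lambda>e \<alpha> z. exp (w' w e * ind z) *
          (\<Prod>\<alpha>'\<in>{\<alpha>'\<in>factors V Cs. e \<in> fvars E Cs \<alpha>'} - {\<alpha>}. fst (bp_msgs V E Cs w t) \<alpha>' e z)))"

definition belief :: "'v set \<Rightarrow> 'v set set \<Rightarrow> 'v list set \<Rightarrow> ('v set \<Rightarrow> real) \<Rightarrow> nat \<Rightarrow> 'v edge' \<Rightarrow> bool \<Rightarrow> real" where
  "belief V E Cs w t e z = exp (w' w e * ind z) *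
     (\<Prod>\<alpha>\<in>{\<alpha>\<in>factors V Cs. e \<in> fvars E Cs \<alpha>}. fst (bp_msgs V E Cs w t) \<alpha> e z)"

definition bp_est :: "'v set \<Rightarrow> 'v set set \<Rightarrow> 'v list set \<Rightarrow> ('v set \<Rightarrow> real) \<Rightarrow> nat \<Rightarrow> 'v edge' \<Rightarrow> bool option" where
  "bp_est V E Cs w t e =
     (if belief V E Cs w t e True > belief V E Cs w t e False then Some True
      else if belief V E Cs w t e True < belief V E Cs w t e False then Some False
      else None)"

definition x_from_y :: "'v list set \<Rightarrow> ('v edge' \<Rightarrow> bool) \<Rightarrow> 'v set \<Rightarrow> real" where
  "x_from_y Cs y e =
     (if \<exists>C\<in>Cs. e \<in> cyc_edges C
      then (let C = (SOME C. C \<in> Cs \<and> e \<in> cyc_edges C)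
            in 1/2 * (\<Sum>j\<in>set C. (-1) ^ (cyc_dist C j e) * ind (y (NewE C j))))
      else ind (y (OldE e)))"

end

theory Submission
  imports Defs
begin

text \<open>Let \<open>y\<^sup>*\<close> be the image of the optimal matching under the linear bijection between edge
  weightings of \<open>G\<close> and \<open>G'\<close>; it maps matchings to feasible assignments of the same weight, which
  settles the MAP part. For convergence, compare the messages of the value that disagrees with
  \<open>y\<^sup>*\<close> and of the value that agrees with it. Every factor has an exchange property: a feasible
  local configuration that disagrees with \<open>y\<^sup>*\<close> at \<open>e\<close> can be corrected at \<open>e\<close> by changing at
  most one further variable \<open>f\<close> where it also disagrees, and the same flip of \<open>y\<^sup>*\<close> is feasible. As
  every variable lies in exactly two factors, unrolling the message updates bounds the
  log-ratio of the beliefs by \<open>w' \<bullet> d\<close>, where \<open>d\<close> adds up the flips of \<open>y\<^sup>*\<close> along a walk. Flips never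
  cancel, and \<open>d\<close> is a direction in the cone of the C-LP at its optimum, up to an error
  at most 1 at each end where time ran out, in which case the walk is long. Since the
  optimum is unique, the directions in the relaxed cone that do not decrease the objective form a
  bounded set, so \<open>w' \<bullet> d < 0\<close> once the time is large.\<close>

section \<open>Trivial cones and distances on an odd cycle\<close>

text \<open>The exchange is of delta-matroid type: a vertex factor allows the sets of at most one
  edge, a cycle factor the vertex sets covered by matchings of the cycle. One and the same pair
  serves both configurations: for the maximiser it produces a competitor for the opposite message,
  for the reference assignment a feasible local move. Since one further variable suffices, the
  unrolled computation is a single walk and not a tree. The obstacle is that the walk may revisit
  edges, so flipping along all of it is not an assignment; only its vector of multiplicities is
  used. Linearity makes this enough: an inequality that is valid at one factor and tight at the
  reference assignment bounds each local move separately, hence their sum. Every active C-LP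
  constraint has this form, except nonnegativity on edges outside the cycles, which follows from the
  constant sign of the flips. Two open ends, each with an error of at most 1, give the relaxation
  constant 2. The relaxed cone is bounded by a compactness argument, so the time of convergence is
  not explicit.\<close>

lemma finite_bounded_subseq:
  fixes f :: "nat \<Rightarrow> 'a \<Rightarrow> real"
  assumes "finite A" and "\<And>n a. a \<in> A \<Longrightarrow> \<bar>f n a\<bar> \<le> B"
  shows "\<exists>r. strict_mono r \<and> (\<forall>a\<in>A. convergent (\<lambda>n. f (r n) a))"
  using assms
proof (induction A rule: finite_induct)
  case empty
  then show ?case using strict_mono_id by auto
next
  case (insert a A)
  then obtain r where r: "strict_mono r" "\<forall>a\<in>A. convergent (\<lambda>n. f (r n) a)"
    by auto
  obtain q where q: "strict_mono q" "monoseq (\<lambda>n. f (r (q n)) a)"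
    using seq_monosub[of "\<lambda>n. f (r n) a"] by auto
  have "Bseq (\<lambda>n. f (r (q n)) a)"
    by (rule BseqI'[of _ B]) (use insert.prems in auto)
  then have a: "convergent (\<lambda>n. f (r (q n)) a)"
    using q(2) by (rule Bseq_monoseq_convergent)
  have "convergent (\<lambda>n. f (r (q n)) b)" if "b \<in> A" for b
    using r(2) that convergent_subseq_convergent[OF _ q(1), of "\<lambda>n. f (r n) b"]
    by (auto simp: o_def)
  moreover have "strict_mono (r \<circ> q)"
    using r(1) q(1) by (rule strict_mono_o)
  ultimately show ?case
    using a by (intro exI[of _ "r \<circ> q"]) (auto simp only: o_def insert_iff)
qed

text \<open>A polyhedron with trivial recession cone is bounded. Unbounded solutions of the relaxed
  system, normalised to length 1, would accumulate at a nonzero vector of the cone itself.\<close>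

lemma trivial_cone_relaxation_bounded:
  fixes A :: "'k \<Rightarrow> 'e \<Rightarrow> real"
  assumes fin: "finite X" and c: "0 \<le> c"
    and triv: "\<And>d. (\<And>k. k \<in> K \<Longrightarrow> (\<Sum>e\<in>X. A k e * d e) \<le> 0) \<Longrightarrow> \<forall>e\<in>X. d e = 0"
  shows "\<exists>L. \<forall>d. (\<forall>k\<in>K. (\<Sum>e\<in>X. A k e * d e) \<le> c) \<longrightarrow> (\<forall>e\<in>X. \<bar>d e\<bar> \<le> L)"
proof (rule ccontr)
  assume "\<not> ?thesis"
  then have "\<forall>n::nat. \<exists>d. (\<forall>k\<in>K. (\<Sum>e\<in>X. A k e * d e) \<le> c) \<and> (\<exists>e\<in>X. \<bar>d e\<bar> > real n)"
    by (meson not_le)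
  then obtain d where d: "\<And>n k. k \<in> K \<Longrightarrow> (\<Sum>e\<in>X. A k e * d n e) \<le> c"
    and big: "\<And>n. \<exists>e\<in>X. \<bar>d n e\<bar> > real n"
    by metis
  \<comment> \<open>The l1 norm: normalised vectors have absolute values summing to exactly 1, a
    property that survives the coordinatewise limit.\<close>
  define N where "N n = (\<Sum>e\<in>X. \<bar>d n e\<bar>)" for n
  have le_N: "\<bar>d n e\<bar> \<le> N n" if "e \<in> X" for n e
    unfolding N_def using that fin by (intro member_le_sum) auto
  have N_gt: "N n > real n" for n
    using big[of n] le_N[of _ n] by fastforce
  then have N_pos: "N n > 0" for n
    by (meson le_less_trans of_nat_0_le_iff)
  have "\<bar>d n e / N n\<bar> \<le> 1" if "e \<in> X" for n e
    using le_N[OF that, of n] N_pos[of n] by (simp add: abs_divide)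
  then obtain r where r: "strict_mono r" "\<forall>e\<in>X. convergent (\<lambda>n. d (r n) e / N (r n))"
    using finite_bounded_subseq[OF fin, of "\<lambda>n e. d n e / N n" 1] by auto
  define u where "u e = lim (\<lambda>n. d (r n) e / N (r n))" for e
  have u: "(\<lambda>n. d (r n) e / N (r n)) \<longlonglongrightarrow> u e" if "e \<in> X" for e
    using r(2) that unfolding u_def by (simp add: convergent_LIMSEQ_iff)
  have N_inf: "filterlim (\<lambda>n. N (r n)) at_top sequentially"
  proof (rule filterlim_at_top_mono[OF filterlim_real_sequentially])
    show "\<forall>\<^sub>F n in sequentially. real n \<le> N (r n)"
      using N_gt seq_suble[OF r(1)] by (intro always_eventually) (meson le_less_trans less_imp_le of_nat_le_iff)
  qed
  \<comment> \<open>Normalising scales the slack \<open>c\<close> away, so the limit satisfies the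
    unrelaxed inequalities.\<close>
  have c0: "(\<lambda>n. c / N (r n)) \<longlonglongrightarrow> 0"
    by (rule tendsto_divide_0[OF tendsto_const]) (rule filterlim_at_top_imp_at_infinity[OF N_inf])
  have "(\<Sum>e\<in>X. A k e * u e) \<le> 0" if "k \<in> K" for k
  proof (rule tendsto_le[OF _ c0])
    show "(\<lambda>n. \<Sum>e\<in>X. A k e * (d (r n) e / N (r n))) \<longlonglongrightarrow> (\<Sum>e\<in>X. A k e * u e)"
      by (intro tendsto_sum tendsto_mult tendsto_const u)
    show "\<forall>\<^sub>F n in sequentially. (\<Sum>e\<in>X. A k e * (d (r n) e / N (r n))) \<le> c / N (r n)"
      using d[OF that] N_pos
      by (intro always_eventually allI)
         (simp add: sum_divide_distrib[symmetric] divide_right_mono less_imp_le)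
  qed simp
  then have "\<forall>e\<in>X. u e = 0" by (rule triv)
  then have "(\<Sum>e\<in>X. \<bar>u e\<bar>) = 0" by simp
  moreover have "(\<lambda>n. \<Sum>e\<in>X. \<bar>d (r n) e / N (r n)\<bar>) \<longlonglongrightarrow> (\<Sum>e\<in>X. \<bar>u e\<bar>)"
    by (intro tendsto_sum tendsto_rabs u)
  moreover have "(\<Sum>e\<in>X. \<bar>d (r n) e / N (r n)\<bar>) = 1" for n
    using N_pos[of "r n"]
    by (simp add: abs_divide sum_divide_distrib[symmetric] N_def[symmetric])
  ultimately show False
    by (simp add: LIMSEQ_const_iff)
qed

lemma cyc_pos_nth:
  assumes "distinct C" "i < length C"
  shows "cyc_pos C (C ! i) = i"
  unfolding cyc_pos_def
  by (rule Least_equality) (use assms nth_eq_iff_index_eq in auto)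

text \<open>The two arcs from a vertex to an edge of the cycle have total length
  \<open>length C - 1\<close>, which is even. Both arcs thus have the same parity, and the sign can
  be read off from the positions without knowing which arc is shorter. For \<open>a > i\<close> the
  near endpoint is \<open>i + 1\<close>, hence the change of sign.\<close>

lemma minus_one_cyc_dist:
  assumes "distinct C" "odd (length C)" "a < length C" "i < length C"
  shows "(-1::real) ^ cyc_dist C (C ! a) {C ! i, C ! (Suc i mod length C)} =
    (if a \<le> i then 1 else -1) * (-1) ^ (a + i)"
proof -
  obtain m where k: "length C = 2 * m + 1"
    using assms(2) by (auto elim: oddE)
  define v where "v b = (let d = (if a \<le> b then b - a else a - b) in min d (length C - d))" for b
  have v: "cyc_vdist C (C ! a) (C ! b) = v b" if "b < length C" for b
    using assms that unfolding cyc_vdist_def v_def by (simp add: cyc_pos_nth Let_def)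
  have "Suc i mod length C < length C"
    using assms(4) by (intro mod_less_divisor) auto
  then have dist: "cyc_dist C (C ! a) {C ! i, C ! (Suc i mod length C)} = min (v i) (v (Suc i mod length C))"
    unfolding cyc_dist_def using assms(4) v by simp
  have even_iff: "even (min (v i) (v (Suc i mod length C))) = (if a \<le> i then even (a + i) else odd (a + i))"
  proof (cases "Suc i = length C")
    case True
    then have i: "i = 2 * m" using k by simp
    have "a \<le> i" using assms True by simp
    have "v i = min (2 * m - a) (Suc a)" "v 0 = min a (2 * m + 1 - a)"
      unfolding v_def using k i \<open>a \<le> i\<close> by (auto simp: Let_def)
    then have "min (v i) (v 0) = (if a \<le> m then a else 2 * m - a)" 
      using \<open>a \<le> i\<close> i by auto
    then show ?thesis using True \<open>a \<le> i\<close> i by auto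
  next
    case False
    then have s: "Suc i mod length C = Suc i" using assms by simp
    show ?thesis
    proof (cases "a \<le> i")
      case True
      have "min (v i) (v (Suc i)) = (if i - a \<le> 2 * m - (i - a) then i - a else 2 * m - (i - a))"
        unfolding v_def using k True False assms by (auto simp: Let_def)
      moreover have "i - a \<le> 2 * m" using assms k by simp
      ultimately show ?thesis using True s by auto
    next
      case f: False
      have "min (v i) (v (Suc i)) =
        (if a - Suc i \<le> 2 * m + 1 - (a - i) then a - Suc i else 2 * m + 1 - (a - i))"
        unfolding v_def using k f False assms by (auto simp: Let_def)
      moreover have "a - i \<le> 2 * m" using assms k by simp
      ultimately show ?thesis using f s by auto
    qed
  qed
  show ?thesis unfolding dist
    by (simp only: minus_one_power_iff even_iff) auto
qed

section \<open>Exchange for matchings of a cycle\<close>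

lemma matching_degree:
  assumes "finite F" "is_matching F N"
  shows "(\<Sum>e\<in>{e\<in>F. j \<in> e}. ind (e \<in> N)) = ind (j \<in> \<Union>N)"
proof (cases "j \<in> \<Union>N")
  case True
  then obtain e where e: "e \<in> N" "j \<in> e" by auto
  have "ind (e' \<in> N) = (if e' = e then 1 else 0)" if "j \<in> e'" for e'
    using e that assms(2) unfolding is_matching_def ind_def by (smt (verit) disjoint_iff)
  then have "(\<Sum>e'\<in>{e\<in>F. j \<in> e}. ind (e' \<in> N)) = (\<Sum>e'\<in>{e\<in>F. j \<in> e}. if e' = e then 1 else 0)"
    by (intro sum.cong) auto
  also have "\<dots> = 1"
    using e assms unfolding is_matching_def by (auto simp: sum.delta')
  finally show ?thesis using True by (simp add: ind_def)
next
  case False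
  then show ?thesis by (auto simp: ind_def intro!: sum.neutral)
qed

lemma is_matching_if_degree_le_1:
  assumes "finite F" "N \<subseteq> F" "\<And>j e. e \<in> N \<Longrightarrow> j \<in> e \<Longrightarrow> (\<Sum>e\<in>{e\<in>F. j \<in> e}. ind (e \<in> N)) \<le> 1"
  shows "is_matching F N"
  unfolding is_matching_def
proof (intro conjI ballI impI)
  fix e1 e2 assume e: "e1 \<in> N" "e2 \<in> N" "e1 \<noteq> e2"
  have False if j: "j \<in> e1" "j \<in> e2" for j
  proof -
    have "2 = (\<Sum>e\<in>{e1,e2}. ind (e \<in> N))" using e by (simp add: ind_def)
    also have "\<dots> \<le> (\<Sum>e\<in>{e\<in>F. j \<in> e}. ind (e \<in> N))"
      by (rule sum_mono2) (use assms e j in \<open>auto simp: ind_def\<close>)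
    finally show False using assms(3)[OF e(1) j(1)] by simp
  qed
  then show "e1 \<inter> e2 = {}" by auto
qed (fact assms(2))

text \<open>A cycle as a function on indices with \<open>v k = v 0\<close>, so that the closing edge
  needs no modulus. The same cycle can be instantiated from every starting vertex and in both
  orientations.\<close>

locale closed_walk =
  fixes v :: "nat \<Rightarrow> 'v" and k :: nat
  assumes len: "3 \<le> k" and inj: "inj_on v {..<k}" and closed: "v k = v 0"
begin

definition edge :: "nat \<Rightarrow> 'v set" where
  "edge t = {v t, v (Suc t)}"

text \<open>The edges at \<open>v t\<close> are \<open>edge t\<close> and
  \<open>edge (pred t)\<close>, so matching and covering become conditions on cyclically adjacent
  indices.\<close>

definition pred :: "nat \<Rightarrow> nat" where
  "pred t = (if t = 0 then k - 1 else t - 1)"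

lemma v_eq_iff: "s < k \<Longrightarrow> t < k \<Longrightarrow> v s = v t \<longleftrightarrow> s = t"
  using inj by (auto simp: inj_on_def)

lemma mem_edge_iff:
  assumes "s < k" "t < k"
  shows "v s \<in> edge t \<longleftrightarrow> t = s \<or> t = pred s"
proof (cases "Suc t = k")
  case True
  then show ?thesis using assms closed v_eq_iff[of s t] v_eq_iff[of s 0] len
    unfolding edge_def pred_def by auto
next
  case False
  then show ?thesis using assms v_eq_iff[of s t] v_eq_iff[of s "Suc t"] 
    unfolding edge_def pred_def by auto
qed

lemma pred_less: "t < k \<Longrightarrow> pred t < k"
  unfolding pred_def using len by auto

lemma pred_neq: "t < k \<Longrightarrow> pred t \<noteq> t" "t < k \<Longrightarrow> pred (pred t) \<noteq> t"
  unfolding pred_def using len by auto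

text \<open>Two indices with the same edge would be predecessors of each other, which
  \<open>3 <= k\<close> excludes.\<close>

lemma edge_eq_iff:
  assumes "s < k" "t < k"
  shows "edge s = edge t \<longleftrightarrow> s = t"
proof
  assume eq: "edge s = edge t"
  have "v s \<in> edge s" "v t \<in> edge t" by (auto simp: edge_def)
  then have "v s \<in> edge t" "v t \<in> edge s" using eq by auto
  then have "t = s \<or> t = pred s" "s = t \<or> s = pred t"
    using mem_edge_iff assms by auto
  then show "s = t" using pred_neq(2)[OF assms(1)] by auto
qed simp

lemma edge_vertex:
  assumes "u \<in> edge t" "t < k"
  obtains s where "s < k" "u = v s"
proof (cases "u = v t")
  case True
  then show ?thesis using assms that by auto
next
  case False
  then have u: "u = v (Suc t)" using assms by (auto simp: edge_def)
  show ?thesis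
  proof (cases "Suc t < k")
    case True
    then show ?thesis using u that by auto
  next
    case False
    then have "Suc t = k" using assms by auto
    then show ?thesis using u closed that[of 0] len by auto
  qed
qed

definition edges :: "'v set set" where
  "edges = edge ` {..<k}"

lemma is_matching_edge_image:
  "is_matching edges (edge ` {t. t < k \<and> x t}) \<longleftrightarrow> (\<forall>t<k. \<not> (x t \<and> x (pred t)))"
proof
  assume m: "is_matching edges (edge ` {t. t < k \<and> x t})"
  show "\<forall>t<k. \<not> (x t \<and> x (pred t))"
  proof (intro allI impI notI)
    fix t assume t: "t < k" "x t \<and> x (pred t)"
    then have "edge t \<noteq> edge (pred t)"
      using edge_eq_iff pred_less pred_neq(1) by metis
    moreover have "v t \<in> edge t \<inter> edge (pred t)"
      using mem_edge_iff t pred_less by auto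
    ultimately show False
      using m t pred_less unfolding is_matching_def by blast
  qed
next
  assume x: "\<forall>t<k. \<not> (x t \<and> x (pred t))"
  have "False" if "s < k" "x s" "t < k" "x t" "s \<noteq> t" "u \<in> edge s" "u \<in> edge t" for s t u
  proof -
    obtain r where "r < k" "u = v r" by (rule edge_vertex[OF \<open>u \<in> edge s\<close> \<open>s < k\<close>])
    then have "s = r \<or> s = pred r" "t = r \<or> t = pred r"
      using that mem_edge_iff by blast+
    then show False using x that \<open>r < k\<close> by blast
  qed
  then show "is_matching edges (edge ` {t. t < k \<and> x t})"
    unfolding is_matching_def edges_def by blast
qed

lemma Union_edge_image:
  assumes "s < k"
  shows "v s \<in> \<Union> (edge ` {t. t < k \<and> x t}) \<longleftrightarrow> x s \<or> x (pred s)"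
proof
  assume "v s \<in> \<Union> (edge ` {t. t < k \<and> x t})"
  then obtain t where t: "t < k" "x t" "v s \<in> edge t" by auto
  then show "x s \<or> x (pred s)" using mem_edge_iff[OF assms t(1)] by auto
next
  have "v s \<in> edge s" "v s \<in> edge (pred s)"
    using mem_edge_iff assms pred_less by auto
  moreover assume "x s \<or> x (pred s)"
  ultimately show "v s \<in> \<Union> (edge ` {t. t < k \<and> x t})"
    using assms pred_less[OF assms] by blast
qed

lemma subset_edges_image:
  assumes "N \<subseteq> edges"
  shows "edge ` {t. t < k \<and> edge t \<in> N} = N"
  using assms unfolding edges_def by blast

text \<open>Swap the two matchings on the maximal run of edges starting at vertex 0 that belong to
  their symmetric difference. No edge adjacent to this run lies in the symmetric difference, so
  both swapped sets are matchings.\<close>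
lemma matching_exchange:
  assumes N: "is_matching edges N" and N': "is_matching edges N'"
    and e0: "edge 0 \<in> N \<longleftrightarrow> edge 0 \<notin> N'" and ek: "edge (k - 1) \<in> N \<longleftrightarrow> edge (k - 1) \<in> N'"
  shows "\<exists>m N1 N1'. 0 < m \<and> m < k \<and> (v m \<in> \<Union>N \<longleftrightarrow> v m \<notin> \<Union>N') \<and>
    is_matching edges N1 \<and> is_matching edges N1' \<and>
    (\<forall>u. u \<in> \<Union>N1 \<longleftrightarrow> (u \<in> \<Union>N \<longleftrightarrow> u \<noteq> v 0 \<and> u \<noteq> v m)) \<and>
    (\<forall>u. u \<in> \<Union>N1' \<longleftrightarrow> (u \<in> \<Union>N' \<longleftrightarrow> u \<noteq> v 0 \<and> u \<noteq> v m))"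
proof -
  define x where "x t \<longleftrightarrow> edge t \<in> N" for t
  define z where "z t \<longleftrightarrow> edge t \<in> N'" for t
  have "N \<subseteq> edges" "N' \<subseteq> edges" using N N' by (auto simp: is_matching_def)
  then have Nx: "N = edge ` {t. t < k \<and> x t}" and Nz: "N' = edge ` {t. t < k \<and> z t}"
    unfolding x_def z_def by (simp_all add: subset_edges_image)
  have x: "\<not> (x t \<and> x (pred t))" and z: "\<not> (z t \<and> z (pred t))" if "t < k" for t
    using N N' that unfolding Nx Nz is_matching_edge_image by auto
  \<comment> \<open>The end of the run: the first index at which the two matchings agree again.
    Index \<open>k - 1\<close> is one by \<open>ek\<close>, so the run stops before the walk closes
    up.\<close>
  define m where "m = (LEAST t. x t = z t)"
  have k1: "x (k - 1) = z (k - 1)" and x0: "x 0 \<noteq> z 0"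
    using ek e0 by (auto simp: x_def z_def)
  have m: "x m = z m" unfolding m_def using k1 by (rule LeastI)
  have "m \<le> k - 1" unfolding m_def using k1 by (rule Least_le)
  then have mk: "m < k" using len by auto
  have m0: "m > 0" using m x0 by (cases m) auto
  have lt: "x t \<noteq> z t" if "t < m" for t
    using that not_less_Least unfolding m_def by blast
  define x1 where "x1 t = (if t < m then z t else x t)" for t
  define z1 where "z1 t = (if t < m then x t else z t)" for t
  have x1: "\<not> (x1 t \<and> x1 (pred t))" and z1: "\<not> (z1 t \<and> z1 (pred t))" if t: "t < k" for t
  proof -
    consider "t = 0" | "0 < t" "t < m" | "t = m" | "t > m" by linarith
    then have "\<not> (x1 t \<and> x1 (pred t)) \<and> \<not> (z1 t \<and> z1 (pred t))"
    proof cases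
      case 1
      then have "pred t = k - 1" "\<not> k - 1 < m" using mk by (auto simp: pred_def)
      then show ?thesis using 1 m0 x[OF t] z[OF t] k1 by (auto simp: x1_def z1_def)
    next
      case 2
      then have "pred t < m" by (auto simp: pred_def)
      then show ?thesis using 2 x[OF t] z[OF t] by (auto simp: x1_def z1_def)
    next
      case 3
      then have "pred t < m" using m0 by (auto simp: pred_def)
      then show ?thesis using 3 x[OF t] z[OF t] m by (auto simp: x1_def z1_def)
    next
      case 4
      then have "\<not> pred t < m" by (auto simp: pred_def)
      then show ?thesis using 4 x[OF t] z[OF t] by (auto simp: x1_def z1_def)
    qed
    then show "\<not> (x1 t \<and> x1 (pred t))" "\<not> (z1 t \<and> z1 (pred t))" by auto
  qed
  let ?N1 = "edge ` {t. t < k \<and> x1 t}" and ?N1' = "edge ` {t. t < k \<and> z1 t}"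
  \<comment> \<open>Inside the run consecutive edges alternate between the two matchings, so each
    inner vertex is covered by both, before and after the swap. At the ends \<open>0\<close> and
    \<open>m\<close> the neighbouring edge outside the run is in neither matching, so exactly one of
    them covers the vertex and the swap toggles both coverages.\<close>
  have cov: "((x1 t \<or> x1 (pred t)) = ((x t \<or> x (pred t)) = (t \<noteq> 0 \<and> t \<noteq> m))) \<and>
    ((z1 t \<or> z1 (pred t)) = ((z t \<or> z (pred t)) = (t \<noteq> 0 \<and> t \<noteq> m)))" if t: "t < k" for t
  proof -
    consider "t = 0" | "0 < t" "t < m" | "t = m" | "t > m" by linarith
    then show ?thesis
    proof cases
      case 1
      then have "pred t = k - 1" "\<not> k - 1 < m" using mk by (auto simp: pred_def)
      then show ?thesis using 1 m0 x[OF t] z[OF t] k1 x0 by (auto simp: x1_def z1_def)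
    next
      case 2
      then have "pred t < m" by (auto simp: pred_def)
      then show ?thesis using 2 x[OF t] z[OF t] lt[of t] lt[of "pred t"] by (auto simp: x1_def z1_def)
    next
      case 3
      then have "pred t < m" using m0 by (auto simp: pred_def)
      then show ?thesis using 3 m0 x[OF t] z[OF t] m lt[of "pred t"] by (auto simp: x1_def z1_def)
    next
      case 4
      then have "\<not> pred t < m" by (auto simp: pred_def)
      then show ?thesis using 4 x[OF t] z[OF t] by (auto simp: x1_def z1_def)
    qed
  qed
  have outside: "u \<notin> \<Union>(edge ` {t. t < k \<and> q t})" if "\<forall>s<k. u \<noteq> v s" for u q
    using that edge_vertex by blast
  have v_inj: "v t = v 0 \<longleftrightarrow> t = 0" "v t = v m \<longleftrightarrow> t = m" if "t < k" for t
    using v_eq_iff that mk len by auto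
  have cov': "(u \<in> \<Union>?N1 \<longleftrightarrow> (u \<in> \<Union>N \<longleftrightarrow> u \<noteq> v 0 \<and> u \<noteq> v m)) \<and>
    (u \<in> \<Union>?N1' \<longleftrightarrow> (u \<in> \<Union>N' \<longleftrightarrow> u \<noteq> v 0 \<and> u \<noteq> v m))" for u
  proof (cases "\<forall>s<k. u \<noteq> v s")
    case True
    have "u \<noteq> v 0" "u \<noteq> v m" using True mk len by auto
    then show ?thesis using outside[OF True] unfolding Nx Nz by blast
  next
    case False
    then obtain s where s: "s < k" and u: "u = v s" by auto
    show ?thesis
      unfolding u Nx Nz Union_edge_image[OF s] v_inj[OF s] by (rule cov[OF s])
  qed
  have "v m \<in> \<Union>N \<longleftrightarrow> v m \<notin> \<Union>N'"
  proof -
    have "pred m < m" using m0 by (auto simp: pred_def)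
    then have "x (pred m) \<noteq> z (pred m)" by (rule lt)
    then show ?thesis unfolding Nx Nz Union_edge_image[OF mk] using m x[OF mk] z[OF mk] by auto
  qed
  moreover have "is_matching edges ?N1" "is_matching edges ?N1'"
    unfolding is_matching_edge_image using x1 z1 by auto
  ultimately show ?thesis
    by (intro exI[of _ m] exI[of _ ?N1] exI[of _ ?N1'] conjI allI m0 mk cov'[THEN conjunct1] cov'[THEN conjunct2])
qed

end

lemma closed_walk_forward:
  assumes "distinct C" "3 \<le> length C"
  shows "closed_walk (\<lambda>t. C ! ((p + t) mod length C)) (length C)"
proof (unfold_locales)
  have "C \<noteq> []" using assms by auto
  show "inj_on (\<lambda>t. C ! ((p + t) mod length C)) {..<length C}"
  proof (rule inj_onI)
    fix s t assume st: "s \<in> {..<length C}" "t \<in> {..<length C}"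
      and "C ! ((p + s) mod length C) = C ! ((p + t) mod length C)"
    then have "(p + s) mod length C = (p + t) mod length C"
      using assms \<open>C \<noteq> []\<close> by (subst (asm) nth_eq_iff_index_eq) auto
    then have "s mod length C = t mod length C"
      by (simp add: nat_mod_eq_iff) 
    then show "s = t" using st by simp
  qed
qed (use assms in auto)

text \<open>Writing \<open>length C - t\<close> before adding \<open>p\<close> avoids truncated
  subtraction; the index reaches \<open>p\<close> again at \<open>t = length C\<close>.\<close>

lemma closed_walk_backward:
  assumes "distinct C" "3 \<le> length C"
  shows "closed_walk (\<lambda>t. C ! ((p + (length C - t)) mod length C)) (length C)"
proof (unfold_locales)
  have "C \<noteq> []" using assms by auto
  show "inj_on (\<lambda>t. C ! ((p + (length C - t)) mod length C)) {..<length C}"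
  proof (rule inj_onI)
    fix s t assume st: "s \<in> {..<length C}" "t \<in> {..<length C}"
      and "C ! ((p + (length C - s)) mod length C) = C ! ((p + (length C - t)) mod length C)"
    then have "(p + (length C - s)) mod length C = (p + (length C - t)) mod length C"
      using assms \<open>C \<noteq> []\<close> by (subst (asm) nth_eq_iff_index_eq) auto
    then have "(length C - s) mod length C = (length C - t) mod length C"
      by (simp add: nat_mod_eq_iff)
    then show "s = t" using st by (cases "s = 0"; cases "t = 0") auto
  qed
qed (use assms in auto)

lemma cyc_edges_image:
  "cyc_edges C = (\<lambda>i. {C ! i, C ! (Suc i mod length C)}) ` {..<length C}"
  unfolding cyc_edges_def by auto

text \<open>One inclusion is index arithmetic; equality follows by counting, since the walk has
  \<open>length C\<close> distinct edges.\<close>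

lemma cyc_edges_forward:
  assumes "distinct C" "3 \<le> length C"
  shows "closed_walk.edges (\<lambda>t. C ! ((p + t) mod length C)) (length C) = cyc_edges C"
proof -
  interpret closed_walk "\<lambda>t. C ! ((p + t) mod length C)" "length C"
    by (rule closed_walk_forward[OF assms])
  have e: "edge t = {C ! ((p + t) mod length C), C ! (Suc ((p + t) mod length C) mod length C)}" for t
    unfolding edge_def by (simp add: mod_Suc_eq)
  have "edges \<subseteq> cyc_edges C"
    unfolding edges_def cyc_edges_image e using len by (auto intro!: imageI mod_less_divisor)
  moreover have "card edges = length C"
    unfolding edges_def using edge_eq_iff by (subst card_image) (auto simp: inj_on_def)
  moreover have "card (cyc_edges C) \<le> length C" "finite (cyc_edges C)"
    unfolding cyc_edges_image by (auto intro: card_image_le[THEN order_trans])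
  ultimately show ?thesis by (metis card_seteq)
qed

lemma cyc_edges_backward:
  assumes "distinct C" "3 \<le> length C"
  shows "closed_walk.edges (\<lambda>t. C ! ((p + (length C - t)) mod length C)) (length C) = cyc_edges C"
proof -
  interpret closed_walk "\<lambda>t. C ! ((p + (length C - t)) mod length C)" "length C"
    by (rule closed_walk_backward[OF assms])
  have "edge t \<in> cyc_edges C" if "t < length C" for t
  proof -
    \<comment> \<open>Against the orientation of the list, step \<open>t\<close> traverses the list
      edge whose first index belongs to step \<open>t + 1\<close>.\<close>
    let ?i = "(p + (length C - Suc t)) mod length C"
    have "Suc ?i mod length C = (p + (length C - t)) mod length C"
      using that by (simp add: mod_Suc_eq Suc_diff_Suc flip: add_Suc_right)
    then have "edge t = {C ! ?i, C ! (Suc ?i mod length C)}" unfolding edge_def by auto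
    moreover have "?i < length C" using len by (intro mod_less_divisor) auto
    ultimately show ?thesis unfolding cyc_edges_image by blast
  qed
  then have "edges \<subseteq> cyc_edges C" unfolding edges_def by auto
  moreover have "card edges = length C"
    unfolding edges_def using edge_eq_iff by (subst card_image) (auto simp: inj_on_def)
  moreover have "card (cyc_edges C) \<le> length C" "finite (cyc_edges C)"
    unfolding cyc_edges_image by (auto intro: card_image_le[THEN order_trans])
  ultimately show ?thesis by (metis card_seteq)
qed

text \<open>Reduces to the exchange along a run by starting the walk at \<open>a\<close> in the
  direction in which the matchings differ.\<close>

lemma cycle_matching_exchange:
  assumes C: "distinct C" "3 \<le> length C"
    and N: "is_matching (cyc_edges C) N" and N': "is_matching (cyc_edges C) N'"
    and a: "a \<in> \<Union>N \<longleftrightarrow> a \<notin> \<Union>N'"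
  shows "\<exists>b\<in>set C. \<exists>N1 N1'. b \<noteq> a \<and> (b \<in> \<Union>N \<longleftrightarrow> b \<notin> \<Union>N') \<and>
    is_matching (cyc_edges C) N1 \<and> is_matching (cyc_edges C) N1' \<and>
    (\<forall>u. u \<in> \<Union>N1 \<longleftrightarrow> (u \<in> \<Union>N \<longleftrightarrow> u \<noteq> a \<and> u \<noteq> b)) \<and>
    (\<forall>u. u \<in> \<Union>N1' \<longleftrightarrow> (u \<in> \<Union>N' \<longleftrightarrow> u \<noteq> a \<and> u \<noteq> b))"
proof -
  have "\<Union>N \<subseteq> \<Union>(cyc_edges C)" "\<Union>N' \<subseteq> \<Union>(cyc_edges C)"
    using N N' unfolding is_matching_def by (auto intro: Union_mono)
  then have "a \<in> \<Union>(cyc_edges C)" using a by (cases "a \<in> \<Union>N") (metis subsetD)+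
  then obtain i where "i < length C" "a = C ! i \<or> a = C ! (Suc i mod length C)"
    unfolding cyc_edges_def by auto
  moreover from this have "Suc i mod length C < length C" by (intro mod_less_divisor) auto
  ultimately have "a \<in> set C" by auto
  then obtain p where p: "p < length C" "a = C ! p" by (metis in_set_conv_nth)
  interpret f: closed_walk "\<lambda>t. C ! ((p + t) mod length C)" "length C"
    by (rule closed_walk_forward[OF C])
  interpret b: closed_walk "\<lambda>t. C ! ((p + (length C - t)) mod length C)" "length C"
    by (rule closed_walk_backward[OF C])
  have fe: "f.edges = cyc_edges C" and be: "b.edges = cyc_edges C"
    using cyc_edges_forward[OF C] cyc_edges_backward[OF C] by auto
  have b0: "b.edge 0 = f.edge (length C - 1)" and bk: "b.edge (length C - 1) = f.edge 0"
  proof -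
    have "Suc (p + length C - Suc 0) = p + length C" using p by auto
    then show "b.edge 0 = f.edge (length C - 1)" "b.edge (length C - 1) = f.edge 0"
      unfolding f.edge_def b.edge_def using p C(2) by auto
  qed
  have 0: "0 < length C" using C by auto
  have nf: "f.edge ` {t. t < length C \<and> f.edge t \<in> N} = N" "f.edge ` {t. t < length C \<and> f.edge t \<in> N'} = N'"
    by (rule f.subset_edges_image, use N N' fe in \<open>simp add: is_matching_def\<close>)+
  have f0: "C ! ((p + 0) mod length C) = a" and b0v: "C ! ((p + (length C - 0)) mod length C) = a"
    using p by auto
  have cov: "a \<in> \<Union>N \<longleftrightarrow> f.edge 0 \<in> N \<or> f.edge (length C - 1) \<in> N"
     "a \<in> \<Union>N' \<longleftrightarrow> f.edge 0 \<in> N' \<or> f.edge (length C - 1) \<in> N'"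
    using f.Union_edge_image[OF 0, of "\<lambda>t. f.edge t \<in> N"] f.Union_edge_image[OF 0, of "\<lambda>t. f.edge t \<in> N'"]
    unfolding nf f0 by (auto simp: f.pred_def)
  have "f.edge 0 \<notin> N \<or> f.edge (length C - 1) \<notin> N" "f.edge 0 \<notin> N' \<or> f.edge (length C - 1) \<notin> N'"
    using f.is_matching_edge_image[of "\<lambda>t. f.edge t \<in> N"] f.is_matching_edge_image[of "\<lambda>t. f.edge t \<in> N'"] N N' 0
    unfolding nf fe by (auto simp: f.pred_def)
  \<comment> \<open>Each matching has at most one of the two edges at \<open>a\<close>, and exactly
    one matching covers \<open>a\<close>. So exactly one of these two edges lies in the symmetric
    difference, and the orientation is chosen to make it edge \<open>0\<close>.\<close>
  then consider
    "f.edge 0 \<in> N \<longleftrightarrow> f.edge 0 \<notin> N'" "f.edge (length C - 1) \<in> N \<longleftrightarrow> f.edge (length C - 1) \<in> N'"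
  | "b.edge 0 \<in> N \<longleftrightarrow> b.edge 0 \<notin> N'" "b.edge (length C - 1) \<in> N \<longleftrightarrow> b.edge (length C - 1) \<in> N'"
    using a cov b0 bk by auto
  then show ?thesis
  proof cases
    case 1
    obtain m N1 N1' where m: "0 < m" "m < length C" and 
      r: "C ! ((p + m) mod length C) \<in> \<Union>N \<longleftrightarrow> C ! ((p + m) mod length C) \<notin> \<Union>N'"
      "is_matching (cyc_edges C) N1" "is_matching (cyc_edges C) N1'"
      "\<forall>u. u \<in> \<Union>N1 \<longleftrightarrow> (u \<in> \<Union>N \<longleftrightarrow> u \<noteq> a \<and> u \<noteq> C ! ((p + m) mod length C))"
      "\<forall>u. u \<in> \<Union>N1' \<longleftrightarrow> (u \<in> \<Union>N' \<longleftrightarrow> u \<noteq> a \<and> u \<noteq> C ! ((p + m) mod length C))"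
      using f.matching_exchange[unfolded fe f0, OF N N' 1] by (elim exE conjE) (rule that)
    have "C ! ((p + m) mod length C) \<noteq> a"
      using f.v_eq_iff[OF m(2) 0] m f0 by auto
    moreover have "C ! ((p + m) mod length C) \<in> set C" using 0 by auto
    ultimately show ?thesis by (intro bexI[of _ "C ! ((p + m) mod length C)"] exI[of _ N1] exI[of _ N1'] conjI r)
  next
    case 2
    obtain m N1 N1' where m: "0 < m" "m < length C" and 
      r: "C ! ((p + (length C - m)) mod length C) \<in> \<Union>N \<longleftrightarrow> C ! ((p + (length C - m)) mod length C) \<notin> \<Union>N'"
      "is_matching (cyc_edges C) N1" "is_matching (cyc_edges C) N1'"
      "\<forall>u. u \<in> \<Union>N1 \<longleftrightarrow> (u \<in> \<Union>N \<longleftrightarrow> u \<noteq> a \<and> u \<noteq> C ! ((p + (length C - m)) mod length C))"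
      "\<forall>u. u \<in> \<Union>N1' \<longleftrightarrow> (u \<in> \<Union>N' \<longleftrightarrow> u \<noteq> a \<and> u \<noteq> C ! ((p + (length C - m)) mod length C))"
      using b.matching_exchange[unfolded be b0v, OF N N' 2] by (elim exE conjE) (rule that)
    have "C ! ((p + (length C - m)) mod length C) \<noteq> a"
      using b.v_eq_iff[OF m(2) 0] m b0v by auto
    moreover have "C ! ((p + (length C - m)) mod length C) \<in> set C" using 0 by auto
    ultimately show ?thesis by (intro bexI[of _ "C ! ((p + (length C - m)) mod length C)"] exI[of _ N1] exI[of _ N1'] conjI r)
  qed
qed

section \<open>Odd cycles\<close>

locale odd_cycle =
  fixes C :: "'v list"
  assumes distinct: "distinct C" and len: "3 \<le> length C" and odd: "odd (length C)"
begin

sublocale walk: closed_walk "\<lambda>t. C ! (t mod length C)" "length C"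
  using closed_walk_forward[OF distinct len, of 0] by simp

lemma walk_edges: "walk.edges = cyc_edges C"
  using cyc_edges_forward[OF distinct len, of 0] by simp

lemma cyc_edges_conv: "cyc_edges C = walk.edge ` {..<length C}"
  using walk_edges walk.edges_def by simp

lemma finite_cyc_edges: "finite (cyc_edges C)"
  by (simp add: cyc_edges_conv)

lemma edge_conv: "t < length C \<Longrightarrow> walk.edge t = {C ! t, C ! (Suc t mod length C)}"
  by (simp add: walk.edge_def)

section \<open>The incidence matrix of an odd cycle and its inverse\<close>

lemma sign:
  assumes "a < length C" "i < length C"
  shows "(-1::real) ^ cyc_dist C (C ! a) (walk.edge i) = (if a \<le> i then 1 else -1) * (-1) ^ (a + i)"
  using minus_one_cyc_dist[OF distinct odd assms] edge_conv[OF assms(2)] by simp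

lemma cyc_edge_subset: "e \<in> cyc_edges C \<Longrightarrow> e \<subseteq> set C"
proof
  fix u assume "e \<in> cyc_edges C" "u \<in> e"
  then obtain t where "t < length C" "u \<in> walk.edge t" by (auto simp: cyc_edges_conv)
  then obtain s where "s < length C" "u = C ! (s mod length C)" 
    by (metis walk.edge_vertex)
  then show "u \<in> set C" by simp
qed

text \<open>Half the sign matrix is the inverse of the vertex-edge incidence matrix; this is one of
  the two products. Passing from one edge at \<open>j\<close> to the other changes the parity of the
  distance from \<open>l\<close>, except that both distances are 0 when
  \<open>l = j\<close>.\<close>

lemma sign_sum_edges_at:
  assumes "l \<in> set C" "j \<in> set C"
  shows "(\<Sum>e\<in>{e\<in>cyc_edges C. j \<in> e}. (-1::real) ^ cyc_dist C l e) = (if l = j then 2 else 0)"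
proof -
  obtain a b where a: "a < length C" "l = C ! a" and b: "b < length C" "j = C ! b"
    using assms by (metis in_set_conv_nth)
  note p = walk.pred_less[OF b(1)]
  have "e \<in> {e\<in>cyc_edges C. j \<in> e} \<longleftrightarrow> e \<in> {walk.edge b, walk.edge (walk.pred b)}" for e
    using walk.mem_edge_iff[OF b(1)] b p unfolding cyc_edges_conv by auto
  then have eq: "{e\<in>cyc_edges C. j \<in> e} = {walk.edge b, walk.edge (walk.pred b)}" by blast
  have ne: "walk.edge b \<noteq> walk.edge (walk.pred b)"
    using walk.edge_eq_iff[OF b(1) p] walk.pred_neq(1)[OF b(1)] by auto
  have "(\<Sum>e\<in>{e\<in>cyc_edges C. j \<in> e}. (-1::real) ^ cyc_dist C l e) =
      (-1) ^ cyc_dist C (C ! a) (walk.edge b) + (-1) ^ cyc_dist C (C ! a) (walk.edge (walk.pred b))"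
    unfolding eq using ne a by simp
  also have "\<dots> = (if a = b then 2 else 0)"
  proof (cases "b = 0")
    case True
    then have "walk.pred b = length C - 1" "even (walk.pred b)" 
      using odd by (auto simp: walk.pred_def)
    then show ?thesis unfolding sign[OF a(1) b(1)] sign[OF a(1) p] using True a odd
      by (auto simp: minus_one_power_iff)
  next
    case False
    then obtain c where "b = Suc c" by (cases b) auto
    moreover have "walk.pred b = c" using \<open>b = Suc c\<close> by (simp add: walk.pred_def)
    ultimately show ?thesis unfolding sign[OF a(1) b(1)] sign[OF a(1) p]
      by (auto simp: minus_one_power_iff)
  qed
  finally show ?thesis using a b distinct by (simp add: nth_eq_iff_index_eq)
qed

lemma nth_neq_next:
  assumes "b < length C"
  shows "C ! b \<noteq> C ! (Suc b mod length C)"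
proof -
  have "Suc b mod length C < length C" using assms by (intro mod_less_divisor) auto
  moreover have "b \<noteq> Suc b mod length C" using assms len by (cases "Suc b = length C") auto
  ultimately show ?thesis using assms distinct by (simp add: nth_eq_iff_index_eq)
qed

text \<open>The product in the other order: the two ends of an edge have distances of opposite
  parity from any other edge.\<close>

lemma sign_sum_ends:
  assumes "e \<in> cyc_edges C" "e' \<in> cyc_edges C"
  shows "(\<Sum>j\<in>e'. (-1::real) ^ cyc_dist C j e) = (if e = e' then 2 else 0)"
proof -
  obtain i b where i: "i < length C" "e = walk.edge i" and b: "b < length C" "e' = walk.edge b"
    using assms by (auto simp: cyc_edges_conv)
  have s: "Suc b mod length C < length C" using b by (intro mod_less_divisor) auto
  have "(\<Sum>j\<in>e'. (-1::real) ^ cyc_dist C j e) =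
    (-1) ^ cyc_dist C (C ! b) (walk.edge i) + (-1) ^ cyc_dist C (C ! (Suc b mod length C)) (walk.edge i)"
    using b i edge_conv nth_neq_next[OF b(1)] by simp
  also have "\<dots> = (if i = b then 2 else 0)"
  proof (cases "Suc b = length C")
    case True
    then have "Suc b mod length C = 0" "even b" "i \<le> b" using odd i(1) by (auto simp flip: True)
    then show ?thesis
      unfolding sign[OF b(1) i(1)] sign[OF s i(1)] by (simp add: minus_one_power_iff)
  next
    case False
    then have "Suc b mod length C = Suc b" using b(1) by simp
    then show ?thesis
      unfolding sign[OF b(1) i(1)] sign[OF s i(1)] by (simp add: minus_one_power_iff)
  qed
  finally show ?thesis using i b walk.edge_eq_iff by simp
qed

lemma sum_edges_at_sign_sum:
  fixes y :: "'v \<Rightarrow> real"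
  assumes "j \<in> set C"
  shows "(\<Sum>e\<in>{e\<in>cyc_edges C. j \<in> e}. 1/2 * (\<Sum>l\<in>set C. (-1) ^ cyc_dist C l e * y l)) = y j"
proof -
  have "(\<Sum>e\<in>{e\<in>cyc_edges C. j \<in> e}. 1/2 * (\<Sum>l\<in>set C. (-1) ^ cyc_dist C l e * y l)) =
    (\<Sum>l\<in>set C. 1/2 * y l * (\<Sum>e\<in>{e\<in>cyc_edges C. j \<in> e}. (-1) ^ cyc_dist C l e))"
    unfolding sum_distrib_left by (subst sum.swap) (simp add: mult_ac)
  also have "\<dots> = (\<Sum>l\<in>set C. if l = j then y l else 0)"
    by (intro sum.cong) (auto simp: sign_sum_edges_at assms)
  finally show ?thesis using assms by simp
qed

lemma sum_vertices_incident:
  fixes h :: "'v \<Rightarrow> 'v set \<Rightarrow> real"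
  shows "(\<Sum>j\<in>set C. \<Sum>e\<in>{e\<in>cyc_edges C. j \<in> e}. h j e) = (\<Sum>e\<in>cyc_edges C. \<Sum>j\<in>e. h j e)"
proof -
  have "(\<Sum>j\<in>set C. \<Sum>e\<in>{e\<in>cyc_edges C. j \<in> e}. h j e) =
    (\<Sum>e\<in>cyc_edges C. \<Sum>j\<in>{j\<in>set C. j \<in> e}. h j e)"
    using finite_cyc_edges by (intro sum.swap_restrict) auto
  also have "\<dots> = (\<Sum>e\<in>cyc_edges C. \<Sum>j\<in>e. h j e)"
    using cyc_edge_subset by (intro sum.cong) auto
  finally show ?thesis .
qed

lemma sign_sum_sum_edges_at:
  fixes x :: "'v set \<Rightarrow> real"
  assumes "e \<in> cyc_edges C"
  shows "1/2 * (\<Sum>j\<in>set C. (-1) ^ cyc_dist C j e * (\<Sum>e'\<in>{e'\<in>cyc_edges C. j \<in> e'}. x e')) = x e"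
proof -
  have "1/2 * (\<Sum>j\<in>set C. (-1) ^ cyc_dist C j e * (\<Sum>e'\<in>{e'\<in>cyc_edges C. j \<in> e'}. x e')) =
    1/2 * (\<Sum>e'\<in>cyc_edges C. \<Sum>j\<in>e'. (-1) ^ cyc_dist C j e * x e')"
    unfolding sum_distrib_left[of "(-1) ^ _"] sum_vertices_incident ..
  also have "\<dots> = (\<Sum>e'\<in>cyc_edges C. 1/2 * (\<Sum>j\<in>e'. (-1) ^ cyc_dist C j e) * x e')"
    by (simp add: sum_distrib_left sum_distrib_right)
  also have "\<dots> = (\<Sum>e'\<in>cyc_edges C. if e = e' then x e' else 0)"
    using assms by (intro sum.cong) (auto simp: sign_sum_ends)
  finally show ?thesis using assms finite_cyc_edges by simp
qed

lemma card_cyc_edge: "e \<in> cyc_edges C \<Longrightarrow> card e = 2"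
proof -
  assume "e \<in> cyc_edges C"
  then obtain b where b: "b < length C" "e = walk.edge b" by (auto simp: cyc_edges_conv)
  then show "card e = 2" using edge_conv nth_neq_next by simp
qed

lemma sum_degrees:
  fixes x :: "'v set \<Rightarrow> real"
  shows "(\<Sum>j\<in>set C. \<Sum>e\<in>{e\<in>cyc_edges C. j \<in> e}. x e) = 2 * (\<Sum>e\<in>cyc_edges C. x e)"
  unfolding sum_vertices_incident by (simp add: card_cyc_edge sum_distrib_left)

section \<open>Cycle factors as vertex sets covered by matchings\<close>

definition covers :: "'v set set \<Rightarrow> ('v \<Rightarrow> bool) \<Rightarrow> bool" where
  "covers N y \<longleftrightarrow> is_matching (cyc_edges C) N \<and> (\<forall>j\<in>set C. y j \<longleftrightarrow> j \<in> \<Union>N)"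

lemma covers_sign_sum:
  assumes "covers N y" "e \<in> cyc_edges C"
  shows "1/2 * (\<Sum>j\<in>set C. (-1) ^ cyc_dist C j e * ind (y j)) = ind (e \<in> N)"
proof -
  have "ind (y j) = (\<Sum>e'\<in>{e'\<in>cyc_edges C. j \<in> e'}. ind (e' \<in> N))" if "j \<in> set C" for j
    using matching_degree[OF finite_cyc_edges, of N j] assms that unfolding covers_def by simp
  then show ?thesis
    using sign_sum_sum_edges_at[OF assms(2), of "\<lambda>e. ind (e \<in> N)"] by simp
qed

text \<open>A matching covers an even number of vertices, so on an odd cycle it misses one.\<close>

lemma covers_sum_le:
  assumes "covers N y"
  shows "(\<Sum>j\<in>set C. ind (y j)) \<le> real (length C) - 1"
proof -
  have N: "N \<subseteq> cyc_edges C" using assms unfolding covers_def is_matching_def by auto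
  have "(\<Sum>j\<in>set C. ind (y j)) = (\<Sum>j\<in>set C. \<Sum>e'\<in>{e'\<in>cyc_edges C. j \<in> e'}. ind (e' \<in> N))"
    using matching_degree[OF finite_cyc_edges, of N] assms unfolding covers_def by (intro sum.cong) auto
  also have "\<dots> = 2 * (\<Sum>e\<in>cyc_edges C. ind (e \<in> N))" by (rule sum_degrees)
  also have "(\<Sum>e\<in>cyc_edges C. ind (e \<in> N)) = real (card N)"
    using N finite_cyc_edges by (simp add: ind_def sum.If_cases Int_absorb1)
  finally have s: "(\<Sum>j\<in>set C. ind (y j)) = real (2 * card N)" by simp
  have "(\<Sum>j\<in>set C. ind (y j)) \<le> (\<Sum>j\<in>set C. 1)" by (intro sum_mono) (simp add: ind_def)
  then have "2 * card N \<le> length C" using s distinct by (simp add: distinct_card)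
  moreover have "2 * card N \<noteq> length C" using odd by (metis dvd_triv_left)
  ultimately have "2 * card N + 1 \<le> length C" by simp
  then show ?thesis unfolding s by linarith
qed

text \<open>The sign sums in \<open>psi_c\<close> are twice the edge values obtained by the inverse
  incidence matrix, so membership in \<open>{0, 2}\<close> says that these values are 0 or 1. Their
  degrees are the Boolean values of \<open>y\<close>, hence at most 1, which makes the edges of
  value 1 a matching.\<close>

lemma psi_c_eq_1_iff: "psi_c C y = 1 \<longleftrightarrow> (\<exists>N. covers N (\<lambda>j. y (NewE C j)))"
proof
  assume psi: "psi_c C y = 1"
  define x where "x e = 1/2 * (\<Sum>j\<in>set C. (-1) ^ cyc_dist C j e * ind (y (NewE C j)))" for e
  define N where "N = {e \<in> cyc_edges C. x e = 1}"
  have x: "x e = ind (e \<in> N)" if "e \<in> cyc_edges C" for e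
    using psi that unfolding psi_c_def x_def N_def ind_def by (auto split: if_splits)
  have deg: "(\<Sum>e\<in>{e\<in>cyc_edges C. j \<in> e}. ind (e \<in> N)) = ind (y (NewE C j))" if "j \<in> set C" for j
    unfolding sum_edges_at_sign_sum[OF that, of "\<lambda>j. ind (y (NewE C j))", symmetric]
    by (intro sum.cong refl) (use x in \<open>auto simp: x_def\<close>)
  have "is_matching (cyc_edges C) N"
  proof (rule is_matching_if_degree_le_1[OF finite_cyc_edges])
    show "N \<subseteq> cyc_edges C" by (auto simp: N_def)
    fix j e assume "e \<in> N" "j \<in> e"
    then have "j \<in> set C" using cyc_edge_subset by (auto simp: N_def)
    then show "(\<Sum>e\<in>{e\<in>cyc_edges C. j \<in> e}. ind (e \<in> N)) \<le> 1"
      by (simp add: deg) (simp add: ind_def)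
  qed
  moreover have "y (NewE C j) \<longleftrightarrow> j \<in> \<Union>N" if "j \<in> set C" for j
    using matching_degree[OF finite_cyc_edges calculation, of j] deg[OF that]
    by (auto simp: ind_def split: if_splits)
  ultimately show "\<exists>N. covers N (\<lambda>j. y (NewE C j))" unfolding covers_def by auto
next
  assume "\<exists>N. covers N (\<lambda>j. y (NewE C j))"
  then obtain N where N: "covers N (\<lambda>j. y (NewE C j))" by auto
  have "(\<Sum>f\<in>delta_c C. ind (y f)) = (\<Sum>j\<in>set C. ind (y (NewE C j)))"
    unfolding delta_c_def by (subst sum.reindex) (auto simp: inj_on_def)
  moreover have "(\<Sum>j\<in>set C. (-1) ^ cyc_dist C j e * ind (y (NewE C j))) \<in> {0, 2}"
    if "e \<in> cyc_edges C" for e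
    using covers_sign_sum[OF N that] by (auto simp: ind_def split: if_splits)
  ultimately show "psi_c C y = 1"
    using covers_sum_le[OF N] unfolding psi_c_def by auto
qed

text \<open>The simultaneous exchange property of the matching delta-matroid of the cycle. A partner
  \<open>b\<close> always exists, in agreement with the even size of covered sets.\<close>

lemma psi_c_exchange:
  assumes "psi_c C Y = 1" "psi_c C Z = 1" "a \<in> set C" "Y (NewE C a) \<noteq> Z (NewE C a)"
  shows "\<exists>b\<in>set C. b \<noteq> a \<and> Y (NewE C b) \<noteq> Z (NewE C b) \<and>
    psi_c C (\<lambda>f. if f \<in> {NewE C a, NewE C b} then \<not> Y f else Y f) = 1 \<and>
    psi_c C (\<lambda>f. if f \<in> {NewE C a, NewE C b} then \<not> Z f else Z f) = 1"
proof -
  obtain N N' where N: "covers N (\<lambda>j. Y (NewE C j))" and N': "covers N' (\<lambda>j. Z (NewE C j))"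
    using assms psi_c_eq_1_iff by blast
  have m: "is_matching (cyc_edges C) N" "is_matching (cyc_edges C) N'"
    using N N' by (auto simp: covers_def)
  have y: "Y (NewE C j) \<longleftrightarrow> j \<in> \<Union>N" "Z (NewE C j) \<longleftrightarrow> j \<in> \<Union>N'" if "j \<in> set C" for j
    using N N' that unfolding covers_def by blast+
  have "a \<in> \<Union>N \<longleftrightarrow> a \<notin> \<Union>N'" using assms(4) y[OF assms(3)] by metis
  from cycle_matching_exchange[OF distinct len m this]
  obtain b N1 N1' where b: "b \<in> set C" "b \<noteq> a" "b \<in> \<Union>N \<longleftrightarrow> b \<notin> \<Union>N'"
    and m1: "is_matching (cyc_edges C) N1" "is_matching (cyc_edges C) N1'"
    and u: "\<forall>u. u \<in> \<Union>N1 \<longleftrightarrow> (u \<in> \<Union>N \<longleftrightarrow> u \<noteq> a \<and> u \<noteq> b)"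
      "\<forall>u. u \<in> \<Union>N1' \<longleftrightarrow> (u \<in> \<Union>N' \<longleftrightarrow> u \<noteq> a \<and> u \<noteq> b)"
    by (elim bexE exE conjE) (rule that)
  have "covers N1 (\<lambda>j. if NewE C j \<in> {NewE C a, NewE C b} then \<not> Y (NewE C j) else Y (NewE C j))"
    unfolding covers_def u(1)[rule_format] using m1 y by simp
  moreover have "covers N1' (\<lambda>j. if NewE C j \<in> {NewE C a, NewE C b} then \<not> Z (NewE C j) else Z (NewE C j))"
    unfolding covers_def u(2)[rule_format] using m1 y by simp
  ultimately have "psi_c C (\<lambda>f. if f \<in> {NewE C a, NewE C b} then \<not> Y f else Y f) = 1"
     "psi_c C (\<lambda>f. if f \<in> {NewE C a, NewE C b} then \<not> Z f else Z f) = 1"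
    unfolding psi_c_eq_1_iff by blast+
  moreover have "Y (NewE C b) \<noteq> Z (NewE C b)" using y[OF b(1)] b(3) by metis
  ultimately show ?thesis using b by blast
qed

text \<open>Makes both message values positive: a single edge at \<open>a\<close> realises
  \<open>True\<close>, the empty matching realises \<open>False\<close>.\<close>

lemma psi_c_attains:
  assumes "a \<in> set C"
  shows "\<exists>Y. Y (NewE C a) = z \<and> (\<forall>f. f \<notin> delta_c C \<longrightarrow> \<not> Y f) \<and> psi_c C Y = 1"
proof -
  have "\<exists>N. is_matching (cyc_edges C) N \<and> (a \<in> \<Union>N \<longleftrightarrow> z)"
  proof (cases z)
    case True
    obtain i where i: "i < length C" "a = C ! i" using assms by (metis in_set_conv_nth)
    then have "a \<in> walk.edge i" by (simp add: edge_conv)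
    then show ?thesis using True i
      by (intro exI[of _ "{walk.edge i}"]) (auto simp: is_matching_def cyc_edges_conv)
  next
    case False
    then show ?thesis by (intro exI[of _ "{}"]) (simp add: is_matching_def)
  qed
  then obtain N where N: "is_matching (cyc_edges C) N" "a \<in> \<Union>N \<longleftrightarrow> z" by blast
  let ?Y = "\<lambda>f. \<exists>j\<in>set C. f = NewE C j \<and> j \<in> \<Union>N"
  have "covers N (\<lambda>j. ?Y (NewE C j))" unfolding covers_def using N by auto
  then have "psi_c C ?Y = 1" using psi_c_eq_1_iff by blast
  then show ?thesis using N assms by (intro exI[of _ ?Y]) (auto simp: delta_c_def)
qed

end

section \<open>The transformed graph\<close>

locale odd_cycle_graph =
  fixes V :: "'v set" and E :: "'v set set" and Cs :: "'v list set"
  assumes graph: "finite_graph V E" and cycles: "odd_cycle_collection V E Cs"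
begin

lemma finite_V: "finite V" and edge_subset: "e \<in> E \<Longrightarrow> e \<subseteq> V" and card_edge: "e \<in> E \<Longrightarrow> card e = 2"
  using graph by (auto simp: finite_graph_def)

lemma finite_E: "finite E"
  using finite_V edge_subset by (intro finite_subset[of E "Pow V"]) auto

lemma finite_Cs: "finite Cs"
  using cycles by (simp add: odd_cycle_collection_def)

lemma odd_cycle: "C \<in> Cs \<Longrightarrow> odd_cycle C"
  using cycles unfolding odd_cycle_collection_def is_cycle_def by unfold_locales auto

lemma cycle_subset: "C \<in> Cs \<Longrightarrow> set C \<subseteq> V" "C \<in> Cs \<Longrightarrow> cyc_edges C \<subseteq> E"
  using cycles unfolding odd_cycle_collection_def is_cycle_def by auto

lemma cycles_disjoint: "C \<in> Cs \<Longrightarrow> C' \<in> Cs \<Longrightarrow> e \<in> cyc_edges C \<Longrightarrow> e \<in> cyc_edges C' \<Longrightarrow> C = C'"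
  using cycles unfolding odd_cycle_collection_def by blast

section \<open>Edges of the transformed graph and the change of variables\<close>

lemma E'_conv: "E' E Cs = OldE ` (E - cyc_union Cs) \<union> (\<Union>C\<in>Cs. NewE C ` set C)"
  unfolding E'_def by auto

lemma finite_E': "finite (E' E Cs)"
  unfolding E'_conv using finite_E finite_Cs by auto

lemma delta_v_subset: "delta_v E Cs i \<subseteq> E' E Cs"
  unfolding delta_v_def E'_def by auto

lemma delta_c_subset: "C \<in> Cs \<Longrightarrow> delta_c C \<subseteq> E' E Cs"
  unfolding delta_c_def E'_def by auto

lemma finite_delta_v: "finite (delta_v E Cs i)"
  using delta_v_subset finite_E' by (rule finite_subset)

lemma sum_delta_c:
  fixes h :: "'v edge' \<Rightarrow> real"
  shows "(\<Sum>f\<in>delta_c C. h f) = (\<Sum>j\<in>set C. h (NewE C j))"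
  unfolding delta_c_def by (subst sum.reindex) (auto simp: inj_on_def)

lemma sum_E':
  fixes h :: "'v edge' \<Rightarrow> real"
  shows "(\<Sum>f\<in>E' E Cs. h f) = (\<Sum>e\<in>E - cyc_union Cs. h (OldE e)) + (\<Sum>C\<in>Cs. \<Sum>j\<in>set C. h (NewE C j))"
proof -
  have "(\<Sum>f\<in>E' E Cs. h f) = (\<Sum>f\<in>OldE ` (E - cyc_union Cs). h f) + (\<Sum>f\<in>(\<Union>C\<in>Cs. NewE C ` set C). h f)"
    unfolding E'_conv using finite_E finite_Cs by (intro sum.union_disjoint) auto
  also have "(\<Sum>f\<in>(\<Union>C\<in>Cs. NewE C ` set C). h f) = (\<Sum>C\<in>Cs. \<Sum>f\<in>NewE C ` set C. h f)"
    using finite_Cs by (intro sum.UNION_disjoint) auto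
  finally show ?thesis by (simp add: sum.reindex inj_on_def)
qed

text \<open>Edge-disjointness of the cycles makes this a partition. The predicate \<open>P\<close>
  covers both the objective and the edges at one vertex.\<close>

lemma sum_E_restrict:
  fixes h :: "'v set \<Rightarrow> real"
  shows "(\<Sum>e\<in>{e\<in>E. P e}. h e) =
    (\<Sum>e\<in>{e\<in>E - cyc_union Cs. P e}. h e) + (\<Sum>C\<in>Cs. \<Sum>e\<in>{e\<in>cyc_edges C. P e}. h e)"
proof -
  have eq: "{e\<in>E. P e} = {e\<in>E - cyc_union Cs. P e} \<union> (\<Union>C\<in>Cs. {e\<in>cyc_edges C. P e})"
    using cycle_subset(2) unfolding cyc_union_def by auto
  have fin: "finite (cyc_edges C)" if "C \<in> Cs" for C
    using odd_cycle.finite_cyc_edges[OF odd_cycle[OF that]] .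
  have "(\<Sum>e\<in>{e\<in>E. P e}. h e) =
    (\<Sum>e\<in>{e\<in>E - cyc_union Cs. P e}. h e) + (\<Sum>e\<in>(\<Union>C\<in>Cs. {e\<in>cyc_edges C. P e}). h e)"
    unfolding eq using finite_E finite_Cs fin by (intro sum.union_disjoint) (auto simp: cyc_union_def)
  also have "(\<Sum>e\<in>(\<Union>C\<in>Cs. {e\<in>cyc_edges C. P e}). h e) = (\<Sum>C\<in>Cs. \<Sum>e\<in>{e\<in>cyc_edges C. P e}. h e)"
    using finite_Cs fin cycles_disjoint by (intro sum.UNION_disjoint) auto
  finally show ?thesis .
qed

text \<open>The formula of \<open>x_from_y\<close>, but on real vectors: it is also applied to
  directions, whose entries need not be 0 or 1.\<close>

definition xmap :: "('v edge' \<Rightarrow> real) \<Rightarrow> 'v set \<Rightarrow> real" where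
  "xmap y e = (if \<exists>C\<in>Cs. e \<in> cyc_edges C
     then (let C = (SOME C. C \<in> Cs \<and> e \<in> cyc_edges C)
           in 1/2 * (\<Sum>j\<in>set C. (-1) ^ cyc_dist C j e * y (NewE C j)))
     else y (OldE e))"

definition ymap :: "('v set \<Rightarrow> real) \<Rightarrow> 'v edge' \<Rightarrow> real" where
  "ymap x f = (case f of OldE e \<Rightarrow> x e | NewE C j \<Rightarrow> \<Sum>e\<in>{e\<in>cyc_edges C. j \<in> e}. x e)"

lemma x_from_y_eq: "x_from_y Cs y e = xmap (\<lambda>f. ind (y f)) e"
  unfolding x_from_y_def xmap_def ..

lemma xmap_cycle:
  assumes "C \<in> Cs" "e \<in> cyc_edges C"
  shows "xmap y e = 1/2 * (\<Sum>j\<in>set C. (-1) ^ cyc_dist C j e * y (NewE C j))"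
proof -
  have "(SOME C. C \<in> Cs \<and> e \<in> cyc_edges C) = C"
    using assms cycles_disjoint by (intro some_equality) auto
  then show ?thesis using assms unfolding xmap_def by (auto simp: Let_def)
qed

lemma xmap_old: "e \<notin> cyc_union Cs \<Longrightarrow> xmap y e = y (OldE e)"
  unfolding xmap_def cyc_union_def by auto

lemma xmap_ymap: "xmap (ymap x) e = x e"
proof (cases "e \<in> cyc_union Cs")
  case True
  then obtain C where C: "C \<in> Cs" "e \<in> cyc_edges C" by (auto simp: cyc_union_def)
  then show ?thesis
    using odd_cycle.sign_sum_sum_edges_at[OF odd_cycle[OF C(1)] C(2), of x]
    unfolding xmap_cycle[OF C] ymap_def by simp
qed (simp add: xmap_old ymap_def)

lemma ymap_xmap:
  assumes "f \<in> E' E Cs"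
  shows "ymap (xmap y) f = y f"
proof (cases f)
  case (OldE e)
  then show ?thesis using assms by (auto simp: ymap_def xmap_old E'_def)
next
  case (NewE C j)
  then have C: "C \<in> Cs" "j \<in> set C" using assms by (auto simp: E'_def)
  have "ymap (xmap y) f =
    (\<Sum>e\<in>{e\<in>cyc_edges C. j \<in> e}. 1/2 * (\<Sum>l\<in>set C. (-1) ^ cyc_dist C l e * y (NewE C l)))"
    unfolding NewE ymap_def using C by (auto intro!: sum.cong simp: xmap_cycle)
  then show ?thesis
    using odd_cycle.sum_edges_at_sign_sum[OF odd_cycle[OF C(1)] C(2), of "\<lambda>l. y (NewE C l)"] NewE
    by simp
qed

text \<open>The new edge from \<open>i\<close> to a cycle carries the total of the cycle edges at
  \<open>i\<close>, so degrees at original vertices are preserved.\<close>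

lemma sum_delta_v_ymap: "(\<Sum>f\<in>delta_v E Cs i. ymap x f) = (\<Sum>e\<in>{e\<in>E. i \<in> e}. x e)"
proof -
  have eq: "delta_v E Cs i = OldE ` {e \<in> E - cyc_union Cs. i \<in> e} \<union> (\<lambda>C. NewE C i) ` {C\<in>Cs. i \<in> set C}"
    unfolding delta_v_def by auto
  have "(\<Sum>f\<in>delta_v E Cs i. ymap x f) =
    (\<Sum>f\<in>OldE ` {e \<in> E - cyc_union Cs. i \<in> e}. ymap x f) + (\<Sum>f\<in>(\<lambda>C. NewE C i) ` {C\<in>Cs. i \<in> set C}. ymap x f)"
    unfolding eq using finite_E finite_Cs by (intro sum.union_disjoint) auto
  also have "\<dots> = (\<Sum>e\<in>{e \<in> E - cyc_union Cs. i \<in> e}. x e) + (\<Sum>C\<in>{C\<in>Cs. i \<in> set C}. \<Sum>e\<in>{e\<in>cyc_edges C. i \<in> e}. x e)"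
    by (simp add: sum.reindex inj_on_def ymap_def)
  also have "(\<Sum>C\<in>{C\<in>Cs. i \<in> set C}. \<Sum>e\<in>{e\<in>cyc_edges C. i \<in> e}. x e) = (\<Sum>C\<in>Cs. \<Sum>e\<in>{e\<in>cyc_edges C. i \<in> e}. x e)"
  proof (intro sum.mono_neutral_left ballI)
    fix C assume C: "C \<in> Cs - {C\<in>Cs. i \<in> set C}"
    then have empty: "{e\<in>cyc_edges C. i \<in> e} = {}"
      using odd_cycle.cyc_edge_subset[OF odd_cycle, of C] by blast
    show "(\<Sum>e\<in>{e\<in>cyc_edges C. i \<in> e}. x e) = 0" unfolding empty by simp
  qed (use finite_Cs in auto)
  finally show ?thesis by (subst sum_E_restrict)
qed

lemma sum_delta_v: "(\<Sum>f\<in>delta_v E Cs i. y f) = (\<Sum>e\<in>{e\<in>E. i \<in> e}. xmap y e)"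
proof -
  have "(\<Sum>f\<in>delta_v E Cs i. y f) = (\<Sum>f\<in>delta_v E Cs i. ymap (xmap y) f)"
    using delta_v_subset by (intro sum.cong refl ymap_xmap[symmetric]) auto
  then show ?thesis by (simp add: sum_delta_v_ymap)
qed

text \<open>Handshake count on the cycle: each edge is counted at its two ends.\<close>

lemma sum_cycle_xmap:
  assumes "C \<in> Cs"
  shows "(\<Sum>e\<in>cyc_edges C. xmap y e) = 1/2 * (\<Sum>j\<in>set C. y (NewE C j))"
proof -
  have "2 * (\<Sum>e\<in>cyc_edges C. xmap y e) = (\<Sum>j\<in>set C. ymap (xmap y) (NewE C j))"
    using odd_cycle.sum_degrees[OF odd_cycle[OF assms], of "xmap y"] by (simp add: ymap_def)
  also have "\<dots> = (\<Sum>j\<in>set C. y (NewE C j))"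
    using assms by (intro sum.cong refl ymap_xmap) (auto simp: E'_def)
  finally show ?thesis by simp
qed

text \<open>On each cycle \<open>w'\<close> is the transpose of \<open>xmap\<close> applied to
  \<open>w\<close>, so the objective is preserved by exchanging the order of summation.\<close>

lemma sum_w': "(\<Sum>f\<in>E' E Cs. w' w f * y f) = (\<Sum>e\<in>E. w e * xmap y e)"
proof -
  have "(\<Sum>j\<in>set C. w' w (NewE C j) * y (NewE C j)) = (\<Sum>e\<in>cyc_edges C. w e * xmap y e)" if C: "C \<in> Cs" for C
  proof -
    have "(\<Sum>j\<in>set C. w' w (NewE C j) * y (NewE C j)) =
      (\<Sum>j\<in>set C. \<Sum>e\<in>cyc_edges C. w e * (1/2 * ((-1) ^ cyc_dist C j e * y (NewE C j))))"
      by (simp add: w'_def sum_distrib_left sum_distrib_right mult_ac)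
    also have "\<dots> = (\<Sum>e\<in>cyc_edges C. w e * (1/2 * (\<Sum>j\<in>set C. (-1) ^ cyc_dist C j e * y (NewE C j))))"
      unfolding sum_distrib_left by (rule sum.swap)
    also have "\<dots> = (\<Sum>e\<in>cyc_edges C. w e * xmap y e)"
      using C by (intro sum.cong) (auto simp: xmap_cycle)
    finally show ?thesis .
  qed
  moreover have "(\<Sum>e\<in>E - cyc_union Cs. w' w (OldE e) * y (OldE e)) = (\<Sum>e\<in>E - cyc_union Cs. w e * xmap y e)"
    by (intro sum.cong) (auto simp: w'_def xmap_old)
  ultimately show ?thesis
    using sum_E_restrict[of "\<lambda>e. w e * xmap y e" "\<lambda>_. True"]
    unfolding sum_E' by (simp add: set_diff_eq)
qed

section \<open>Feasible assignments, matchings and the MAP\<close>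

definition feasible :: "('v edge' \<Rightarrow> bool) \<Rightarrow> bool" where
  "feasible y \<longleftrightarrow> (\<forall>i\<in>V. psi_v E Cs i y = 1) \<and> (\<forall>C\<in>Cs. psi_c C y = 1)"

text \<open>Membership in \<open>E' E Cs\<close> is demanded because elements of
  \<open>assignments\<close> vanish outside it, so that MAP uniqueness is an equality of
  functions.\<close>

definition matching_assignment :: "'v set set \<Rightarrow> 'v edge' \<Rightarrow> bool" where
  "matching_assignment M f \<longleftrightarrow> f \<in> E' E Cs \<and> ymap (\<lambda>e. ind (e \<in> M)) f = 1"

lemma is_matching_subset_cycle:
  assumes "is_matching E M" "C \<in> Cs"
  shows "is_matching (cyc_edges C) (M \<inter> cyc_edges C)"
  using assms unfolding is_matching_def by blast

lemma ymap_matching_cycle: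
  assumes M: "is_matching E M" and C: "C \<in> Cs"
  shows "ymap (\<lambda>e. ind (e \<in> M)) (NewE C j) = ind (j \<in> \<Union>(M \<inter> cyc_edges C))"
proof -
  have "ymap (\<lambda>e. ind (e \<in> M)) (NewE C j) = (\<Sum>e\<in>{e\<in>cyc_edges C. j \<in> e}. ind (e \<in> M \<inter> cyc_edges C))"
    unfolding ymap_def by (auto intro!: sum.cong)
  then show ?thesis
    using matching_degree[OF odd_cycle.finite_cyc_edges[OF odd_cycle[OF C]] is_matching_subset_cycle[OF M C], of j] by simp
qed

lemma ind_eq_1_iff [simp]: "ind P = 1 \<longleftrightarrow> P"
  by (simp add: ind_def)

lemma ind_matching_assignment:
  assumes "is_matching E M" "f \<in> E' E Cs"
  shows "ind (matching_assignment M f) = ymap (\<lambda>e. ind (e \<in> M)) f"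
proof -
  have "ymap (\<lambda>e. ind (e \<in> M)) f \<in> {0, 1}"
  proof (cases f)
    case (OldE e)
    then show ?thesis by (simp add: ymap_def ind_def)
  next
    case (NewE C j)
    then have "C \<in> Cs" using assms by (auto simp: E'_def)
    then show ?thesis using ymap_matching_cycle[OF assms(1)] unfolding NewE by (simp add: ind_def)
  qed
  then show ?thesis using assms(2) by (auto simp: matching_assignment_def ind_def)
qed

lemma xmap_cong:
  assumes "e \<in> E" "\<And>f. f \<in> E' E Cs \<Longrightarrow> y f = y' f"
  shows "xmap y e = xmap y' e"
proof (cases "e \<in> cyc_union Cs")
  case True
  then obtain C where C: "C \<in> Cs" "e \<in> cyc_edges C" by (auto simp: cyc_union_def)
  have "y (NewE C j) = y' (NewE C j)" if "j \<in> set C" for j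
    using C that by (intro assms(2)) (auto simp: E'_def)
  then show ?thesis unfolding xmap_cycle[OF C] by simp
next
  case False
  then show ?thesis using assms by (simp add: xmap_old E'_def)
qed

lemma xmap_matching_assignment:
  assumes "is_matching E M" "e \<in> E"
  shows "xmap (\<lambda>f. ind (matching_assignment M f)) e = ind (e \<in> M)"
  using xmap_cong[OF assms(2), of "\<lambda>f. ind (matching_assignment M f)" "ymap (\<lambda>e. ind (e \<in> M))"]
    ind_matching_assignment[OF assms(1)] xmap_ymap by simp

lemma feasible_matching_assignment:
  assumes M: "is_matching E M"
  shows "feasible (matching_assignment M)"
  unfolding feasible_def
proof (intro conjI ballI)
  fix i assume "i \<in> V"
  have "(\<Sum>f\<in>delta_v E Cs i. ind (matching_assignment M f)) = (\<Sum>e\<in>{e\<in>E. i \<in> e}. ind (e \<in> M))"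
    unfolding sum_delta_v using xmap_matching_assignment[OF M] by (intro sum.cong) auto
  then show "psi_v E Cs i (matching_assignment M) = 1"
    unfolding psi_v_def using matching_degree[OF finite_E M, of i] by (simp add: ind_def)
next
  fix C assume C: "C \<in> Cs"
  interpret odd_cycle C by (rule odd_cycle[OF C])
  have "covers (M \<inter> cyc_edges C) (\<lambda>j. matching_assignment M (NewE C j))"
    unfolding covers_def
    using is_matching_subset_cycle[OF M C] ymap_matching_cycle[OF M C] C
    by (auto simp: matching_assignment_def E'_def)
  then show "psi_c C (matching_assignment M) = 1" unfolding psi_c_eq_1_iff by blast
qed

text \<open>On cycles the covering matching makes \<open>xmap\<close> 0/1-valued, elsewhere
  \<open>y\<close> is Boolean already. The vertex factors then bound the degrees, since
  \<open>xmap\<close> preserves them.\<close>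

lemma feasible_imp_matching:
  assumes y: "feasible y" "\<And>f. f \<notin> E' E Cs \<Longrightarrow> \<not> y f"
  shows "\<exists>M. is_matching E M \<and> y = matching_assignment M"
proof -
  let ?x = "xmap (\<lambda>f. ind (y f))"
  define M where "M = {e\<in>E. ?x e = 1}"
  have x: "?x e = ind (e \<in> M)" if "e \<in> E" for e
  proof (cases "e \<in> cyc_union Cs")
    case True
    then obtain C where C: "C \<in> Cs" "e \<in> cyc_edges C" by (auto simp: cyc_union_def)
    then obtain N where N: "odd_cycle.covers C N (\<lambda>j. y (NewE C j))"
      using y(1) odd_cycle.psi_c_eq_1_iff[OF odd_cycle[OF C(1)]] unfolding feasible_def by blast
    then have "?x e = ind (e \<in> N)"
      using odd_cycle.covers_sign_sum[OF odd_cycle[OF C(1)] N C(2)] unfolding xmap_cycle[OF C] by simp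
    then show ?thesis using that by (auto simp: M_def ind_def)
  next
    case False
    then show ?thesis using that by (auto simp: M_def xmap_old ind_def)
  qed
  have "is_matching E M"
  proof (rule is_matching_if_degree_le_1[OF finite_E])
    fix j e assume "e \<in> M" "j \<in> e"
    then have "j \<in> V" using edge_subset by (auto simp: M_def)
    have "(\<Sum>e\<in>{e\<in>E. j \<in> e}. ind (e \<in> M)) = (\<Sum>f\<in>delta_v E Cs j. ind (y f))"
      unfolding sum_delta_v using x by (intro sum.cong) auto
    also have "\<dots> \<le> 1"
      using y(1) \<open>j \<in> V\<close> by (auto simp: feasible_def psi_v_def split: if_splits)
    finally show "(\<Sum>e\<in>{e\<in>E. j \<in> e}. ind (e \<in> M)) \<le> 1" .
  qed (auto simp: M_def)
  moreover have "y f = matching_assignment M f" for f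
  proof (cases "f \<in> E' E Cs")
    case True
    have "ymap (\<lambda>e. ind (e \<in> M)) f = ymap ?x f"
    proof (cases f)
      case (OldE e)
      then show ?thesis using True x by (auto simp: ymap_def E'_def)
    next
      case (NewE C j)
      then have "C \<in> Cs" using True by (auto simp: E'_def)
      then have "e \<in> E" if "e \<in> cyc_edges C" for e using cycle_subset(2) that by blast
      then show ?thesis using x unfolding NewE ymap_def by (auto intro!: sum.cong)
    qed
    then show ?thesis using True ymap_xmap[OF True, of "\<lambda>f. ind (y f)"]
      by (simp add: matching_assignment_def)
  qed (use y(2) in \<open>auto simp: matching_assignment_def\<close>)
  ultimately show ?thesis by blast
qed

lemma gm_weight_eq:
  "gm_weight V E Cs w y = (if feasible y then exp (\<Sum>e\<in>E. w e * xmap (\<lambda>f. ind (y f)) e) else 0)"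
proof (cases "feasible y")
  case True
  have "(\<Prod>f\<in>E' E Cs. exp (w' w f * ind (y f))) = exp (\<Sum>e\<in>E. w e * xmap (\<lambda>f. ind (y f)) e)"
    unfolding sum_w'[symmetric] using finite_E' by (simp add: exp_sum)
  then show ?thesis using True unfolding gm_weight_def feasible_def by simp
next
  case False
  then have "(\<exists>i\<in>V. psi_v E Cs i y = 0) \<or> (\<exists>C\<in>Cs. psi_c C y = 0)"
    unfolding feasible_def psi_v_def psi_c_def by (meson ind_eq_1_iff)
  then show ?thesis using False finite_V finite_Cs unfolding gm_weight_def by (auto simp: prod_zero_iff)
qed

lemma gm_weight_matching:
  assumes "is_matching E M"
  shows "gm_weight V E Cs w (matching_assignment M) = exp (sum w M)"
proof -
  have "(\<Sum>e\<in>E. w e * xmap (\<lambda>f. ind (matching_assignment M f)) e) = (\<Sum>e\<in>E. if e \<in> M then w e else 0)"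
    using xmap_matching_assignment[OF assms] by (intro sum.cong) (auto simp: ind_def)
  also have "\<dots> = sum w M"
    using assms finite_E by (simp add: sum.If_cases is_matching_def Int_absorb1)
  finally show ?thesis using feasible_matching_assignment[OF assms] by (simp add: gm_weight_eq)
qed

lemma finite_assignments: "finite (assignments E Cs)"
proof -
  have "assignments E Cs \<subseteq> (\<lambda>S f. f \<in> S) ` Pow (E' E Cs)"
  proof
    fix y assume "y \<in> assignments E Cs"
    then have "y = (\<lambda>f. f \<in> {f. y f})" "{f. y f} \<in> Pow (E' E Cs)" by (auto simp: assignments_def)
    then show "y \<in> (\<lambda>S f. f \<in> S) ` Pow (E' E Cs)" by blast
  qed
  then show ?thesis by (rule finite_subset) (simp add: finite_E')
qed

lemma matching_assignment_mem: "matching_assignment M \<in> assignments E Cs"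
  by (auto simp: assignments_def matching_assignment_def)

text \<open>The empty matching has positive weight, so the normalising constant is positive and can
  be cancelled.\<close>

lemma gm_prob_le_iff: "gm_prob V E Cs w y \<le> gm_prob V E Cs w y' \<longleftrightarrow> gm_weight V E Cs w y \<le> gm_weight V E Cs w y'"
proof -
  have nonneg: "gm_weight V E Cs w y \<ge> 0" for y by (simp add: gm_weight_eq)
  have e: "is_matching E {}" by (simp add: is_matching_def)
  have "0 < gm_weight V E Cs w (matching_assignment {})" by (simp add: gm_weight_matching[OF e])
  also have "\<dots> \<le> (\<Sum>y'\<in>assignments E Cs. gm_weight V E Cs w y')"
    using finite_assignments matching_assignment_mem nonneg by (intro member_le_sum) auto
  finally show ?thesis unfolding gm_prob_def by (simp add: divide_le_cancel)
qed

lemma is_MAP_iff: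
  "is_MAP V E Cs w y \<longleftrightarrow> (\<exists>M. is_max_weight_matching E w M \<and> y = matching_assignment M)"
proof
  assume y: "is_MAP V E Cs w y"
  have e: "is_matching E {}" by (simp add: is_matching_def)
  have "0 < gm_weight V E Cs w (matching_assignment {})" by (simp add: gm_weight_matching[OF e])
  also have "\<dots> \<le> gm_weight V E Cs w y"
    using y matching_assignment_mem unfolding is_MAP_def gm_prob_le_iff by auto
  finally have "feasible y" by (auto simp: gm_weight_eq split: if_splits)
  then obtain M where M: "is_matching E M" "y = matching_assignment M"
    using feasible_imp_matching[of y] y by (auto simp: is_MAP_def assignments_def)
  have "sum w M' \<le> sum w M" if M': "is_matching E M'" for M'
    using y matching_assignment_mem[of M'] unfolding is_MAP_def gm_prob_le_iff M(2)
    by (auto simp: gm_weight_matching M' M(1))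
  then show "\<exists>M. is_max_weight_matching E w M \<and> y = matching_assignment M"
    using M by (auto simp: is_max_weight_matching_def)
next
  assume "\<exists>M. is_max_weight_matching E w M \<and> y = matching_assignment M"
  then obtain M where M: "is_max_weight_matching E w M" and y: "y = matching_assignment M" by blast
  then have m: "is_matching E M" by (simp add: is_max_weight_matching_def)
  have "gm_weight V E Cs w y' \<le> gm_weight V E Cs w y" if y': "y' \<in> assignments E Cs" for y'
  proof (cases "feasible y'")
    case True
    then obtain M' where "is_matching E M'" "y' = matching_assignment M'"
      using feasible_imp_matching[of y'] y' by (auto simp: assignments_def)
    then show ?thesis using M m y by (simp add: gm_weight_matching is_max_weight_matching_def)
  qed (simp add: gm_weight_eq)
  then show "is_MAP V E Cs w y"
    unfolding is_MAP_def gm_prob_le_iff using matching_assignment_mem y by auto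
qed

end

section \<open>Belief propagation\<close>

definition flip :: "'a set \<Rightarrow> ('a \<Rightarrow> bool) \<Rightarrow> 'a \<Rightarrow> bool" where
  "flip S y f = (if f \<in> S then \<not> y f else y f)"

context odd_cycle_graph
begin

section \<open>The factor graph and the exchange property of its factors\<close>

lemma factorsE:
  assumes "\<alpha> \<in> factors V Cs"
  obtains (vertex) i where "\<alpha> = FV i" "i \<in> V" | (cycle) C where "\<alpha> = FC C" "C \<in> Cs"
  using assms unfolding factors_def by auto

lemma fvars_subset: "\<alpha> \<in> factors V Cs \<Longrightarrow> fvars E Cs \<alpha> \<subseteq> E' E Cs"
  by (erule factorsE) (simp_all add: fvars_def delta_v_subset delta_c_subset)

lemma finite_fvars: "\<alpha> \<in> factors V Cs \<Longrightarrow> finite (fvars E Cs \<alpha>)"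
  using fvars_subset finite_E' by (meson finite_subset)

text \<open>An old edge belongs to its two endpoints, a new edge to its vertex and its cycle. Stated
  relative to \<alpha>, it names the factor through which a walk that came from \<alpha> along
  \<open>f\<close> continues.\<close>

lemma two_factors:
  assumes "f \<in> E' E Cs" "\<alpha> \<in> factors V Cs" "f \<in> fvars E Cs \<alpha>"
  shows "\<exists>\<beta>. \<beta> \<noteq> \<alpha> \<and> {\<beta> \<in> factors V Cs. f \<in> fvars E Cs \<beta>} = {\<alpha>, \<beta>}"
proof -
  have "\<exists>\<beta> \<gamma>. \<beta> \<noteq> \<gamma> \<and> {\<beta> \<in> factors V Cs. f \<in> fvars E Cs \<beta>} = {\<beta>, \<gamma>}"
  proof (cases f)
    case (OldE e)
    then have e: "e \<in> E - cyc_union Cs" using assms(1) by (auto simp: E'_def)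
    then obtain i j where ij: "e = {i, j}" "i \<noteq> j" using card_edge by (metis Diff_iff card_2_iff)
    have "{\<beta> \<in> factors V Cs. f \<in> fvars E Cs \<beta>} = FV ` (V \<inter> e)"
      using e unfolding OldE by (auto simp: factors_def fvars_def delta_v_def delta_c_def)
    moreover have "V \<inter> e = {i, j}" using edge_subset[of e] e ij(1) by auto
    ultimately have "{\<beta> \<in> factors V Cs. f \<in> fvars E Cs \<beta>} = {FV i, FV j}" by simp
    then show ?thesis using ij(2) by (intro exI[of _ "FV i"] exI[of _ "FV j"]) simp
  next
    case (NewE C j)
    then have C: "C \<in> Cs" "j \<in> set C" using assms(1) by (auto simp: E'_def)
    then have "j \<in> V" using cycle_subset by auto
    then have "{\<beta> \<in> factors V Cs. f \<in> fvars E Cs \<beta>} = {FV j, FC C}"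
      using C unfolding NewE by (auto simp: factors_def fvars_def delta_v_def delta_c_def)
    then show ?thesis by (intro exI[of _ "FV j"] exI[of _ "FC C"]) simp
  qed
  then obtain \<beta> \<gamma> where bg: "\<beta> \<noteq> \<gamma>" "{\<beta> \<in> factors V Cs. f \<in> fvars E Cs \<beta>} = {\<beta>, \<gamma>}"
    by (elim exE conjE) (rule that)
  then have "\<alpha> \<in> {\<beta>, \<gamma>}" using assms(2,3) by blast
  then show ?thesis
  proof
    assume "\<alpha> = \<beta>" then show ?thesis using bg by (intro exI[of _ \<gamma>]) simp
  next
    assume "\<alpha> \<in> {\<gamma>}" then show ?thesis using bg by (intro exI[of _ \<beta>]) (simp add: insert_commute)
  qed
qed

lemma psi_v_eq_1_iff:
  "psi_v E Cs i y = 1 \<longleftrightarrow> (\<forall>f\<in>delta_v E Cs i. \<forall>g\<in>delta_v E Cs i. y f \<longrightarrow> y g \<longrightarrow> f = g)"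
proof -
  let ?S = "{f\<in>delta_v E Cs i. y f}"
  have "(\<Sum>f\<in>delta_v E Cs i. ind (y f)) = real (card ?S)"
    using finite_delta_v by (simp add: ind_def sum.If_cases Int_def)
  moreover have "card ?S \<le> 1 \<longleftrightarrow> (\<forall>f\<in>?S. \<forall>g\<in>?S. f = g)"
    using finite_delta_v by (simp add: card_le_Suc0_iff_eq)
  ultimately show ?thesis unfolding psi_v_def by auto
qed

lemma psi_fac_range: "psi_fac E Cs \<alpha> y \<in> {0, 1}"
  unfolding psi_fac_def psi_v_def psi_c_def by (auto split: fac.split)

text \<open>At a vertex the partner is the edge selected by the other configuration, and
  \<open>S\<close> is empty if there is none. At a cycle \<open>S\<close> is always a
  singleton.\<close>

lemma psi_fac_exchange:
  assumes \<alpha>: "\<alpha> \<in> factors V Cs" and Y: "psi_fac E Cs \<alpha> Y = 1" and Z: "psi_fac E Cs \<alpha> Z = 1"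
    and e: "e \<in> fvars E Cs \<alpha>" "Y e \<noteq> Z e"
  shows "\<exists>S. S \<subseteq> fvars E Cs \<alpha> - {e} \<and> (S = {} \<or> (\<exists>f. S = {f})) \<and> (\<forall>f\<in>S. Y f \<noteq> Z f) \<and>
    psi_fac E Cs \<alpha> (flip (insert e S) Y) = 1 \<and> psi_fac E Cs \<alpha> (flip (insert e S) Z) = 1"
  using \<alpha>
proof (cases rule: factorsE)
  case (vertex i)
  \<comment> \<open>The claim is symmetric in \<open>Y\<close> and \<open>Z\<close>, so only the
    case in which \<open>Y\<close> selects \<open>e\<close> is proved; the other case swaps the
    roles.\<close>
  have *: "\<exists>S. S \<subseteq> delta_v E Cs i - {e} \<and> (S = {} \<or> (\<exists>f. S = {f})) \<and> (\<forall>f\<in>S. Y f \<noteq> Z f) \<and>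
      psi_v E Cs i (flip (insert e S) Y) = 1 \<and> psi_v E Cs i (flip (insert e S) Z) = 1"
    if Y: "psi_v E Cs i Y = 1" and Z: "psi_v E Cs i Z = 1" and e: "e \<in> delta_v E Cs i" "Y e" "\<not> Z e"
    for Y Z
  proof (cases "\<exists>f\<in>delta_v E Cs i. Z f")
    case True
    then obtain f where f: "f \<in> delta_v E Cs i" "Z f" by blast
    have "f \<noteq> e" using f e by auto
    have Y': "Y g \<longleftrightarrow> g = e" if "g \<in> delta_v E Cs i" for g
      using Y e that unfolding psi_v_eq_1_iff by blast
    have Z': "Z g \<longleftrightarrow> g = f" if "g \<in> delta_v E Cs i" for g
      using Z f that unfolding psi_v_eq_1_iff by blast
    show ?thesis
      using f \<open>f \<noteq> e\<close> Y' Z' by (intro exI[of _ "{f}"]) (auto simp: psi_v_eq_1_iff flip_def)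
  next
    case False
    have Y': "Y g \<longleftrightarrow> g = e" if "g \<in> delta_v E Cs i" for g
      using Y e that unfolding psi_v_eq_1_iff by blast
    then show ?thesis
      using False by (intro exI[of _ "{}"]) (auto simp: psi_v_eq_1_iff flip_def)
  qed
  show ?thesis
  proof (cases "Y e")
    case True
    then show ?thesis using *[of Y Z] Y Z e unfolding vertex psi_fac_def fvars_def by simp
  next
    case False
    then show ?thesis using *[of Z Y] Y Z e unfolding vertex psi_fac_def fvars_def by auto
  qed
next
  case (cycle C)
  obtain a where a: "e = NewE C a" "a \<in> set C" using e cycle by (auto simp: fvars_def delta_c_def)
  then obtain b where b: "b \<in> set C" "b \<noteq> a" "Y (NewE C b) \<noteq> Z (NewE C b)"
    "psi_c C (\<lambda>f. if f \<in> {NewE C a, NewE C b} then \<not> Y f else Y f) = 1"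
    "psi_c C (\<lambda>f. if f \<in> {NewE C a, NewE C b} then \<not> Z f else Z f) = 1"
    using odd_cycle.psi_c_exchange[OF odd_cycle[OF cycle(2)], of Y Z a] Y Z e
    unfolding cycle psi_fac_def by auto
  then show ?thesis
    unfolding a cycle psi_fac_def fvars_def flip_def delta_c_def
    by (intro exI[of _ "{NewE C b}"]) auto
qed

lemma psi_fac_attains:
  assumes \<alpha>: "\<alpha> \<in> factors V Cs" and e: "e \<in> fvars E Cs \<alpha>"
  shows "\<exists>Y\<in>local_configs E Cs \<alpha> e z. psi_fac E Cs \<alpha> Y = 1"
  using \<alpha>
proof (cases rule: factorsE)
  case (vertex i)
  then have "(\<lambda>f. f = e \<and> z) \<in> local_configs E Cs \<alpha> e z"
    using e by (auto simp: local_configs_def)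
  moreover have "psi_fac E Cs \<alpha> (\<lambda>f. f = e \<and> z) = 1"
    unfolding vertex psi_fac_def by (simp add: psi_v_eq_1_iff)
  ultimately show ?thesis by blast
next
  case (cycle C)
  obtain a where "e = NewE C a" "a \<in> set C" using e cycle by (auto simp: fvars_def delta_c_def)
  then show ?thesis
    using odd_cycle.psi_c_attains[OF odd_cycle[OF cycle(2)], of a z]
    unfolding cycle local_configs_def psi_fac_def fvars_def by auto
qed

section \<open>Positivity of messages and attainment of the maximum\<close>

abbreviation fmsg :: "('v set \<Rightarrow> real) \<Rightarrow> nat \<Rightarrow> 'v fac \<Rightarrow> 'v edge' \<Rightarrow> bool \<Rightarrow> real" where
  "fmsg w t \<equiv> fst (bp_msgs V E Cs w t)"

abbreviation vmsg :: "('v set \<Rightarrow> real) \<Rightarrow> nat \<Rightarrow> 'v edge' \<Rightarrow> 'v fac \<Rightarrow> bool \<Rightarrow> real" where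
  "vmsg w t \<equiv> snd (bp_msgs V E Cs w t)"

lemma finite_local_configs:
  assumes "\<alpha> \<in> factors V Cs"
  shows "finite (local_configs E Cs \<alpha> e z)"
proof -
  have "local_configs E Cs \<alpha> e z \<subseteq> assignments E Cs"
    using fvars_subset[OF assms] by (auto simp: local_configs_def assignments_def)
  then show ?thesis using finite_assignments by (rule finite_subset)
qed

lemma fmsg_Suc_ge:
  assumes "\<alpha> \<in> factors V Cs" "Y \<in> local_configs E Cs \<alpha> e z" "psi_fac E Cs \<alpha> Y = 1"
  shows "(\<Prod>f\<in>fvars E Cs \<alpha> - {e}. vmsg w t f \<alpha> (Y f)) \<le> fmsg w (Suc t) \<alpha> e z"
proof -
  let ?g = "\<lambda>Y. psi_fac E Cs \<alpha> Y * (\<Prod>f\<in>fvars E Cs \<alpha> - {e}. vmsg w t f \<alpha> (Y f))"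
  have "?g Y \<le> Max (?g ` local_configs E Cs \<alpha> e z)"
    by (intro Max_ge finite_imageI imageI finite_local_configs assms)
  then show ?thesis using assms(3) by simp
qed

text \<open>Positivity permits logarithms. For factor messages it is restricted to variables of the
  factor: for any other variable and \<open>z = True\<close> there are no local configurations, and
  the \<open>Max\<close> is unspecified.\<close>

lemma msg_pos:
  "(\<forall>\<alpha>\<in>factors V Cs. \<forall>e\<in>fvars E Cs \<alpha>. \<forall>z. 0 < fmsg w t \<alpha> e z) \<and> (\<forall>f \<alpha> z. 0 < vmsg w t f \<alpha> z)"
proof (induction t)
  case 0
  then show ?case by simp
next
  case (Suc t)
  have "0 < fmsg w (Suc t) \<alpha> e z" if \<alpha>: "\<alpha> \<in> factors V Cs" "e \<in> fvars E Cs \<alpha>" for \<alpha> e z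
  proof -
    obtain Y where Y: "Y \<in> local_configs E Cs \<alpha> e z" "psi_fac E Cs \<alpha> Y = 1"
      using psi_fac_attains[OF \<alpha>] by blast
    have "0 < (\<Prod>f\<in>fvars E Cs \<alpha> - {e}. vmsg w t f \<alpha> (Y f))"
      using Suc.IH by (intro prod_pos) auto
    also have "\<dots> \<le> fmsg w (Suc t) \<alpha> e z" by (rule fmsg_Suc_ge[OF \<alpha>(1) Y])
    finally show ?thesis .
  qed
  moreover have "0 < vmsg w (Suc t) f \<alpha> z" for f \<alpha> z
    using Suc.IH by (auto intro!: mult_pos_pos prod_pos)
  ultimately show ?case by blast
qed

lemma fmsg_pos: "\<alpha> \<in> factors V Cs \<Longrightarrow> e \<in> fvars E Cs \<alpha> \<Longrightarrow> 0 < fmsg w t \<alpha> e z"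
  and vmsg_pos: "0 < vmsg w t f \<alpha> z"
  using msg_pos by blast+

lemma fmsg_Suc_attained:
  assumes \<alpha>: "\<alpha> \<in> factors V Cs" "e \<in> fvars E Cs \<alpha>"
  shows "\<exists>Y\<in>local_configs E Cs \<alpha> e z. psi_fac E Cs \<alpha> Y = 1 \<and>
    fmsg w (Suc t) \<alpha> e z = (\<Prod>f\<in>fvars E Cs \<alpha> - {e}. vmsg w t f \<alpha> (Y f))"
proof -
  let ?g = "\<lambda>Y. psi_fac E Cs \<alpha> Y * (\<Prod>f\<in>fvars E Cs \<alpha> - {e}. vmsg w t f \<alpha> (Y f))"
  have "Max (?g ` local_configs E Cs \<alpha> e z) \<in> ?g ` local_configs E Cs \<alpha> e z"
    using finite_local_configs[OF \<alpha>(1)] psi_fac_attains[OF \<alpha>] by (intro Max_in) auto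
  then obtain Y where Y: "Y \<in> local_configs E Cs \<alpha> e z" "fmsg w (Suc t) \<alpha> e z = ?g Y" by auto
  \<comment> \<open>A maximiser violating the factor would give the message value 0.\<close>
  then have "psi_fac E Cs \<alpha> Y \<noteq> 0" using fmsg_pos[OF \<alpha>, of w "Suc t" z] by auto
  then have "psi_fac E Cs \<alpha> Y = 1" using psi_fac_range[of \<alpha> Y] by auto
  then show ?thesis using Y by auto
qed

end

section \<open>Log-ratios of messages and alternating walks\<close>

locale bp_matching = odd_cycle_graph V E Cs
  for V :: "'v set" and E :: "'v set set" and Cs :: "'v list set" +
  fixes w :: "'v set \<Rightarrow> real" and M :: "'v set set"
  assumes matching: "is_matching E M"
begin

definition ys :: "'v edge' \<Rightarrow> bool" where
  "ys = matching_assignment M"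

text \<open>The change of the variable when \<open>ys\<close> is flipped at \<open>f\<close>. It
  depends on \<open>f\<close> alone, so repeated visits of a walk to \<open>f\<close> add up with
  the same sign.\<close>

definition dir :: "'v edge' \<Rightarrow> real" where
  "dir f = ind (\<not> ys f) - ind (ys f)"

lemma dir_cases: "dir f = 1 \<or> dir f = -1"
  by (simp add: dir_def ind_def)

definition fdiff :: "nat \<Rightarrow> 'v fac \<Rightarrow> 'v edge' \<Rightarrow> real" where
  "fdiff t \<alpha> e = ln (fmsg w t \<alpha> e (\<not> ys e)) - ln (fmsg w t \<alpha> e (ys e))"

definition vdiff :: "nat \<Rightarrow> 'v edge' \<Rightarrow> 'v fac \<Rightarrow> real" where
  "vdiff t f \<alpha> = ln (vmsg w t f \<alpha> (\<not> ys f)) - ln (vmsg w t f \<alpha> (ys f))"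

lemma psi_fac_ys: "\<alpha> \<in> factors V Cs \<Longrightarrow> psi_fac E Cs \<alpha> ys = 1"
  using feasible_matching_assignment[OF matching]
  by (auto elim!: factorsE simp: ys_def feasible_def psi_fac_def)

text \<open>Exchanging the maximiser for the disagreeing value gives a candidate for the agreeing
  one, and all incoming messages outside \<open>S\<close> cancel in the ratio. Feasibility of the
  same flip of \<open>ys\<close> is recorded for use with tight inequalities.\<close>

lemma fdiff_Suc:
  assumes \<alpha>: "\<alpha> \<in> factors V Cs" and e: "e \<in> fvars E Cs \<alpha>"
  shows "\<exists>S. S \<subseteq> fvars E Cs \<alpha> - {e} \<and> (S = {} \<or> (\<exists>f. S = {f})) \<and>
    psi_fac E Cs \<alpha> (flip (insert e S) ys) = 1 \<and> fdiff (Suc t) \<alpha> e \<le> (\<Sum>f\<in>S. vdiff t f \<alpha>)"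
proof -
  let ?F = "fvars E Cs \<alpha> - {e}"
  obtain Y where Y: "Y \<in> local_configs E Cs \<alpha> e (\<not> ys e)" "psi_fac E Cs \<alpha> Y = 1"
    and Y_max: "fmsg w (Suc t) \<alpha> e (\<not> ys e) = (\<Prod>f\<in>?F. vmsg w t f \<alpha> (Y f))"
    using fmsg_Suc_attained[OF \<alpha> e] by blast
  have "Y e \<noteq> ys e" using Y by (auto simp: local_configs_def)
  from psi_fac_exchange[OF \<alpha> Y(2) psi_fac_ys[OF \<alpha>] e this]
  obtain S where S: "S \<subseteq> ?F" "S = {} \<or> (\<exists>f. S = {f})" "\<forall>f\<in>S. Y f \<noteq> ys f"
    and psi: "psi_fac E Cs \<alpha> (flip (insert e S) Y) = 1" "psi_fac E Cs \<alpha> (flip (insert e S) ys) = 1"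
    by blast
  let ?Y = "flip (insert e S) Y"
  have "?Y \<in> local_configs E Cs \<alpha> e (ys e)"
    using Y(1) S(1) e by (auto simp: local_configs_def flip_def)
  then have "(\<Prod>f\<in>?F. vmsg w t f \<alpha> (?Y f)) \<le> fmsg w (Suc t) \<alpha> e (ys e)"
    using fmsg_Suc_ge[OF \<alpha>] psi(1) by blast
  moreover have "0 < (\<Prod>f\<in>?F. vmsg w t f \<alpha> (?Y f))" by (intro prod_pos) (auto simp: vmsg_pos)
  ultimately have "ln (\<Prod>f\<in>?F. vmsg w t f \<alpha> (?Y f)) \<le> ln (fmsg w (Suc t) \<alpha> e (ys e))"
    by (simp del: bp_msgs.simps)
  then have "fdiff (Suc t) \<alpha> e \<le> ln (\<Prod>f\<in>?F. vmsg w t f \<alpha> (Y f)) - ln (\<Prod>f\<in>?F. vmsg w t f \<alpha> (?Y f))"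
    unfolding fdiff_def Y_max by simp
  also have "\<dots> = (\<Sum>f\<in>?F. ln (vmsg w t f \<alpha> (Y f)) - ln (vmsg w t f \<alpha> (?Y f)))"
    using vmsg_pos finite_fvars[OF \<alpha>] by (simp add: ln_prod less_imp_neq[symmetric] sum_subtractf)
  also have "\<dots> = (\<Sum>f\<in>?F. if f \<in> S then vdiff t f \<alpha> else 0)"
    using S(3) by (intro sum.cong) (auto simp: vdiff_def flip_def)
  also have "\<dots> = (\<Sum>f\<in>S. vdiff t f \<alpha>)"
    using S(1) finite_fvars[OF \<alpha>] by (simp add: sum.If_cases Int_absorb1)
  finally show ?thesis using S psi by blast
qed

lemma vdiff_Suc:
  assumes "{\<beta> \<in> factors V Cs. f \<in> fvars E Cs \<beta>} = {\<alpha>, \<beta>}" "\<beta> \<noteq> \<alpha>"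
  shows "vdiff (Suc t) f \<alpha> = dir f * w' w f + fdiff t \<beta> f"
proof -
  have "\<beta> \<in> factors V Cs" "f \<in> fvars E Cs \<beta>" using assms(1) by blast+
  note pos = fmsg_pos[OF this, of w t]
  have "{\<beta> \<in> factors V Cs. f \<in> fvars E Cs \<beta>} - {\<alpha>} = {\<beta>}" using assms by auto
  then have "vmsg w (Suc t) f \<alpha> z = exp (w' w f * ind z) * fmsg w t \<beta> f z" for z by simp
  then have "ln (vmsg w (Suc t) f \<alpha> z) = w' w f * ind z + ln (fmsg w t \<beta> f z)" for z
    using pos[of z] by (simp del: bp_msgs.simps add: ln_mult)
  then show ?thesis unfolding vdiff_def fdiff_def dir_def by (simp del: bp_msgs.simps add: algebra_simps)
qed

text \<open>A linear inequality valid on the configurations allowed by the factor and attained at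
  \<open>ys\<close>. Keeping it abstract treats vertex and cycle factors alike; the bound on the
  coefficients limits the effect of a single unpaired flip to 1.\<close>

definition tight :: "'v fac \<Rightarrow> ('v edge' \<Rightarrow> real) \<Rightarrow> bool" where
  "tight \<beta> a \<longleftrightarrow> \<beta> \<in> factors V Cs \<and> (\<forall>f. \<bar>a f\<bar> \<le> 1) \<and>
    (\<forall>Y. psi_fac E Cs \<beta> Y = 1 \<longrightarrow> (\<Sum>f\<in>fvars E Cs \<beta>. a f * (ind (Y f) - ind (ys f))) \<le> 0)"

lemma tight_flip:
  assumes "tight \<beta> a" "psi_fac E Cs \<beta> (flip S ys) = 1" "S \<subseteq> fvars E Cs \<beta>"
  shows "(\<Sum>f\<in>S. a f * dir f) \<le> 0"
proof -
  have "(\<Sum>f\<in>S. a f * dir f) = (\<Sum>f\<in>fvars E Cs \<beta>. if f \<in> S then a f * dir f else 0)"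
    using assms finite_fvars by (simp add: sum.If_cases Int_absorb1 tight_def)
  also have "\<dots> = (\<Sum>f\<in>fvars E Cs \<beta>. a f * (ind (flip S ys f) - ind (ys f)))"
    by (intro sum.cong) (auto simp: flip_def dir_def)
  also have "\<dots> \<le> 0" using assms unfolding tight_def by blast
  finally show ?thesis .
qed

lemma abs_tight_dir: "tight \<beta> a \<Longrightarrow> a f * dir f \<le> 1"
  using dir_cases[of f] unfolding tight_def by (auto simp: abs_le_iff)

text \<open>Here \<open>d\<close> accumulates the edges of an alternating walk that leaves \<open>e\<close> through
  \<open>\<alpha>\<close>. It violates a tight inequality only at the last factor of a walk that ran out of time,
  and then by at most 1; this is recorded in \<open>\<kappa>\<close>.\<close>

definition walk_bound :: "nat \<Rightarrow> 'v fac \<Rightarrow> 'v edge' \<Rightarrow> ('v edge' \<Rightarrow> real) \<Rightarrow> real \<Rightarrow> bool" where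
  "walk_bound t \<alpha> e d \<kappa> \<longleftrightarrow>
     fdiff t \<alpha> e \<le> (\<Sum>f\<in>E' E Cs. w' w f * d f) \<and> (\<forall>f. 0 \<le> dir f * d f) \<and>
     (\<kappa> = 0 \<or> \<kappa> = 1 \<and> real (t div 2) \<le> (\<Sum>f\<in>E' E Cs. \<bar>d f\<bar>)) \<and>
     (\<forall>\<beta> a. tight \<beta> a \<longrightarrow>
       (\<Sum>f\<in>fvars E Cs \<beta>. a f * d f) + (if \<beta> = \<alpha> then a e * dir e else 0) \<le> \<kappa>)"

text \<open>The vector \<open>d\<close> does not contain the starting edge \<open>e\<close>, whose
  term at \<alpha> is therefore added separately. Prepending \<open>f\<close>: at \<alpha> the flips
  of \<open>e\<close> and \<open>f\<close> form a feasible pair and contribute at most 0; at \<beta>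
  the separate term of \<open>f\<close> becomes part of the sum; no other factor contains
  \<open>f\<close>. Two rounds of messages lengthen the walk by one edge.\<close>

lemma walk_bound_extend:
  assumes \<alpha>: "\<alpha> \<in> factors V Cs" "e \<in> fvars E Cs \<alpha>" and f: "f \<in> fvars E Cs \<alpha>" "f \<noteq> e"
    and psi: "psi_fac E Cs \<alpha> (flip {e, f} ys) = 1"
    and \<beta>: "{\<beta> \<in> factors V Cs. f \<in> fvars E Cs \<beta>} = {\<alpha>, \<beta>}" "\<beta> \<noteq> \<alpha>"
    and d: "walk_bound t \<beta> f d \<kappa>"
    and le: "fdiff (Suc (Suc t)) \<alpha> e \<le> dir f * w' w f + fdiff t \<beta> f"
  shows "walk_bound (Suc (Suc t)) \<alpha> e (\<lambda>g. d g + (if g = f then dir f else 0)) \<kappa>"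
proof -
  let ?d = "\<lambda>g. d g + (if g = f then dir f else 0)"
  have fE: "f \<in> E' E Cs" using \<alpha> f fvars_subset by blast
  have sum_d: "(\<Sum>g\<in>X. h g * ?d g) = (\<Sum>g\<in>X. h g * d g) + (if f \<in> X then h f * dir f else 0)"
    if "finite X" for X and h :: "'v edge' \<Rightarrow> real"
  proof -
    have "(\<Sum>g\<in>X. h g * ?d g) = (\<Sum>g\<in>X. h g * d g) + (\<Sum>g\<in>X. if g = f then h g * dir f else 0)"
      unfolding sum.distrib[symmetric] by (intro sum.cong) (auto simp: algebra_simps)
    then show ?thesis using that by (simp add: sum.delta)
  qed
  have pos: "0 \<le> dir g * d g" for g using d unfolding walk_bound_def by blast
  \<comment> \<open>With consistent signs the total absolute value is linear in \<open>d\<close>, so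
    the new edge adds exactly 1 to it.\<close>
  have abs_d: "\<bar>?d g\<bar> = dir g * ?d g" "\<bar>d g\<bar> = dir g * d g" for g
    using pos[of g] dir_cases[of g] by auto
  have "fdiff (Suc (Suc t)) \<alpha> e \<le> (\<Sum>g\<in>E' E Cs. w' w g * ?d g)"
    using le d fE unfolding sum_d[OF finite_E'] walk_bound_def by (simp add: mult.commute)
  moreover have "0 \<le> dir g * ?d g" for g
    using pos[of g] dir_cases[of g] by auto
  moreover have "\<kappa> = 0 \<or> \<kappa> = 1 \<and> real (Suc (Suc t) div 2) \<le> (\<Sum>g\<in>E' E Cs. \<bar>?d g\<bar>)"
  proof -
    have "(\<Sum>g\<in>E' E Cs. \<bar>?d g\<bar>) = (\<Sum>g\<in>E' E Cs. \<bar>d g\<bar>) + 1"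
      unfolding abs_d sum_d[OF finite_E'] using fE dir_cases[of f] by auto
    then show ?thesis using d unfolding walk_bound_def by auto
  qed
  moreover have "(\<Sum>g\<in>fvars E Cs \<gamma>. a g * ?d g) + (if \<gamma> = \<alpha> then a e * dir e else 0) \<le> \<kappa>"
    if tight: "tight \<gamma> a" for \<gamma> a
  proof -
    have \<gamma>: "\<gamma> \<in> factors V Cs" using tight by (simp add: tight_def)
    have IH: "(\<Sum>g\<in>fvars E Cs \<gamma>. a g * d g) + (if \<gamma> = \<beta> then a f * dir f else 0) \<le> \<kappa>"
      using d tight unfolding walk_bound_def by blast
    consider "\<gamma> = \<alpha>" | "\<gamma> = \<beta>" | "\<gamma> \<noteq> \<alpha>" "\<gamma> \<noteq> \<beta>" by blast
    then show ?thesis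
    proof cases
      case 1
      then have "a e * dir e + a f * dir f \<le> 0"
        using tight_flip[OF tight, of "{e, f}"] psi \<alpha> f by simp
      then show ?thesis using IH 1 \<beta>(2) f unfolding sum_d[OF finite_fvars[OF \<gamma>]] by simp
    next
      case 2
      have "f \<in> fvars E Cs \<beta>" using \<beta>(1) by blast
      then show ?thesis using IH 2 \<beta>(2) unfolding sum_d[OF finite_fvars[OF \<gamma>]] by simp
    next
      case 3
      have "f \<notin> fvars E Cs \<gamma>" using \<beta>(1) 3 \<gamma> by blast
      then show ?thesis using IH 3 unfolding sum_d[OF finite_fvars[OF \<gamma>]] by simp
    qed
  qed
  ultimately show ?thesis unfolding walk_bound_def by blast
qed

lemma walk_bound_exists:
  assumes "\<alpha> \<in> factors V Cs" "e \<in> fvars E Cs \<alpha>"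
  shows "\<exists>d \<kappa>. walk_bound t \<alpha> e d \<kappa>"
  using assms
\<comment> \<open>Induction in steps of two, as one edge of the walk takes a variable-to-factor and
  a factor-to-variable update.\<close>
proof (induction t arbitrary: \<alpha> e rule: induct_nat_012)
  case 0
  \<comment> \<open>Time has run out: all messages are 1, the walk is empty, and the unpaired flip
    of \<open>e\<close> costs at most 1.\<close>
  then have "walk_bound 0 \<alpha> e (\<lambda>_. 0) 1"
    unfolding walk_bound_def fdiff_def by (auto simp: abs_tight_dir)
  then show ?case by blast
next
  case 1
  have "vdiff 0 f \<alpha> = 0" for f by (simp add: vdiff_def)
  then have "fdiff (Suc 0) \<alpha> e \<le> 0" using fdiff_Suc[OF 1, of 0] by auto
  then have "walk_bound (Suc 0) \<alpha> e (\<lambda>_. 0) 1"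
    unfolding walk_bound_def by (auto simp: abs_tight_dir)
  then show ?case by blast
next
  case (ge2 t)
  note \<alpha> = ge2.prems
  obtain S where S: "S \<subseteq> fvars E Cs \<alpha> - {e}" "S = {} \<or> (\<exists>f. S = {f})"
    and psi: "psi_fac E Cs \<alpha> (flip (insert e S) ys) = 1"
    and le: "fdiff (Suc (Suc t)) \<alpha> e \<le> (\<Sum>f\<in>S. vdiff (Suc t) f \<alpha>)"
    using fdiff_Suc[OF \<alpha>, of "Suc t"] by blast
  show ?case
  proof (cases "S = {}")
    case True
    \<comment> \<open>The walk ends properly: flipping \<open>e\<close> alone is feasible at
      \<alpha>, so there is no error.\<close>
    have "a e * dir e \<le> 0" if "tight \<alpha> a" for a
      using tight_flip[OF that, of "{e}"] psi True \<alpha> by simp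
    then have "walk_bound (Suc (Suc t)) \<alpha> e (\<lambda>_. 0) 0"
      using le True unfolding walk_bound_def by simp
    then show ?thesis by blast
  next
    case False
    then obtain f where f: "S = {f}" using S(2) by blast
    have fa: "f \<in> fvars E Cs \<alpha>" "f \<noteq> e" using f S(1) by auto
    obtain \<beta> where \<beta>: "\<beta> \<noteq> \<alpha>" "{\<beta> \<in> factors V Cs. f \<in> fvars E Cs \<beta>} = {\<alpha>, \<beta>}"
      using two_factors[OF _ \<alpha>(1) fa(1)] fvars_subset[OF \<alpha>(1)] fa(1) by blast
    then have "\<beta> \<in> factors V Cs" "f \<in> fvars E Cs \<beta>" by blast+
    then obtain d \<kappa> where d: "walk_bound t \<beta> f d \<kappa>" using ge2.IH(1) by blast
    have "fdiff (Suc (Suc t)) \<alpha> e \<le> dir f * w' w f + fdiff t \<beta> f"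
      using le unfolding f by (simp add: vdiff_Suc[OF \<beta>(2,1)])
    then show ?thesis
      using walk_bound_extend[OF \<alpha> fa _ \<beta>(2,1) d] psi f by blast
  qed
qed

text \<open>Glues the walks leaving \<open>e\<close> through its two factors. Counting
  \<open>e\<close> once in \<open>d\<close> supplies the term missing at both factors. The errors
  add up to at most 2, and a nonzero error means that one of the two walks is long. The flip of
  \<open>e\<close> is not cancelled, so \<open>d e\<close> is nonzero.\<close>

lemma belief_bound:
  assumes e: "e \<in> E' E Cs"
  shows "\<exists>d \<kappa>. ln (belief V E Cs w t e (\<not> ys e)) - ln (belief V E Cs w t e (ys e)) \<le> (\<Sum>f\<in>E' E Cs. w' w f * d f) \<and>
    (\<forall>f. 0 \<le> dir f * d f) \<and> d e \<noteq> 0 \<and>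
    (\<kappa> = 0 \<or> \<kappa> \<le> 2 \<and> real (t div 2) \<le> (\<Sum>f\<in>E' E Cs. \<bar>d f\<bar>)) \<and>
    (\<forall>\<beta> a. tight \<beta> a \<longrightarrow> (\<Sum>f\<in>fvars E Cs \<beta>. a f * d f) \<le> \<kappa>)"
proof -
  obtain \<alpha> where \<alpha>: "\<alpha> \<in> factors V Cs" "e \<in> fvars E Cs \<alpha>"
  proof (cases e)
    case (OldE u)
    then have u: "u \<in> E - cyc_union Cs" using e by (auto simp: E'_def)
    then obtain i where "i \<in> u" using card_edge[of u] by fastforce
    then show thesis using that[of "FV i"] u edge_subset OldE
      by (auto simp: factors_def fvars_def delta_v_def)
  next
    case (NewE C j)
    then show thesis using that[of "FC C"] e by (auto simp: factors_def fvars_def delta_c_def E'_def)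
  qed
  obtain \<beta> where \<beta>: "\<beta> \<noteq> \<alpha>" "{\<beta> \<in> factors V Cs. e \<in> fvars E Cs \<beta>} = {\<alpha>, \<beta>}"
    using two_factors[OF e \<alpha>] by blast
  then have \<beta>': "\<beta> \<in> factors V Cs" "e \<in> fvars E Cs \<beta>" by blast+
  have "belief V E Cs w t e z = exp (w' w e * ind z) * (fmsg w t \<alpha> e z * fmsg w t \<beta> e z)" for z
    unfolding belief_def \<beta>(2) using \<beta>(1) by simp
  then have "ln (belief V E Cs w t e z) = w' w e * ind z + ln (fmsg w t \<alpha> e z) + ln (fmsg w t \<beta> e z)" for z
    using fmsg_pos[OF \<alpha>, of w t z] fmsg_pos[OF \<beta>', of w t z] by (simp add: ln_mult)
  then have diff: "ln (belief V E Cs w t e (\<not> ys e)) - ln (belief V E Cs w t e (ys e)) =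
      w' w e * dir e + fdiff t \<alpha> e + fdiff t \<beta> e"
    unfolding fdiff_def dir_def by (simp add: algebra_simps)
  obtain d1 \<kappa>1 where d1: "walk_bound t \<alpha> e d1 \<kappa>1" using walk_bound_exists[OF \<alpha>] by blast
  obtain d2 \<kappa>2 where d2: "walk_bound t \<beta> e d2 \<kappa>2" using walk_bound_exists[OF \<beta>'] by blast
  define d where "d f = d1 f + d2 f + (if f = e then dir e else 0)" for f
  have sum_d: "(\<Sum>g\<in>X. h g * d g) = (\<Sum>g\<in>X. h g * d1 g) + (\<Sum>g\<in>X. h g * d2 g) + (if e \<in> X then h e * dir e else 0)"
    if "finite X" for X and h :: "'v edge' \<Rightarrow> real"
  proof -
    have "(\<Sum>g\<in>X. h g * d g) =
      (\<Sum>g\<in>X. h g * d1 g) + (\<Sum>g\<in>X. h g * d2 g) + (\<Sum>g\<in>X. if g = e then h g * dir e else 0)"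
      unfolding sum.distrib[symmetric] d_def by (intro sum.cong) (auto simp: algebra_simps)
    then show ?thesis using that by (simp add: sum.delta)
  qed
  have pos: "0 \<le> dir g * d1 g" "0 \<le> dir g * d2 g" for g
    using d1 d2 unfolding walk_bound_def by blast+
  have pos_d: "0 \<le> dir g * d g" for g
    using pos[of g] dir_cases[of g] by (auto simp: d_def)
  have "ln (belief V E Cs w t e (\<not> ys e)) - ln (belief V E Cs w t e (ys e)) \<le> (\<Sum>f\<in>E' E Cs. w' w f * d f)"
    using d1 d2 e unfolding diff sum_d[OF finite_E'] walk_bound_def by simp
  moreover have "d e \<noteq> 0"
    using pos[of e] dir_cases[of e] by (auto simp: d_def)
  moreover have "\<kappa>1 + \<kappa>2 = 0 \<or> \<kappa>1 + \<kappa>2 \<le> 2 \<and> real (t div 2) \<le> (\<Sum>f\<in>E' E Cs. \<bar>d f\<bar>)"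
  proof -
    have "\<bar>d1 g\<bar> \<le> \<bar>d g\<bar>" "\<bar>d2 g\<bar> \<le> \<bar>d g\<bar>" for g
      using pos[of g] dir_cases[of g] by (auto simp: d_def)
    then have "(\<Sum>f\<in>E' E Cs. \<bar>d1 f\<bar>) \<le> (\<Sum>f\<in>E' E Cs. \<bar>d f\<bar>)" "(\<Sum>f\<in>E' E Cs. \<bar>d2 f\<bar>) \<le> (\<Sum>f\<in>E' E Cs. \<bar>d f\<bar>)"
      by (auto intro: sum_mono)
    then show ?thesis using d1 d2 unfolding walk_bound_def by auto
  qed
  moreover have "(\<Sum>f\<in>fvars E Cs \<gamma>. a f * d f) \<le> \<kappa>1 + \<kappa>2" if tight: "tight \<gamma> a" for \<gamma> a
  proof -
    have \<gamma>: "\<gamma> \<in> factors V Cs" using tight by (simp add: tight_def)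
    have 1: "(\<Sum>g\<in>fvars E Cs \<gamma>. a g * d1 g) + (if \<gamma> = \<alpha> then a e * dir e else 0) \<le> \<kappa>1"
      and 2: "(\<Sum>g\<in>fvars E Cs \<gamma>. a g * d2 g) + (if \<gamma> = \<beta> then a e * dir e else 0) \<le> \<kappa>2"
      using d1 d2 tight unfolding walk_bound_def by blast+
    have "e \<in> fvars E Cs \<gamma> \<longleftrightarrow> \<gamma> = \<alpha> \<or> \<gamma> = \<beta>" using \<beta>(2) \<gamma> by blast
    then show ?thesis using 1 2 \<beta>(1) unfolding sum_d[OF finite_fvars[OF \<gamma>]] by (auto split: if_splits)
  qed
  ultimately show ?thesis using pos_d by blast
qed

end

section \<open>Convergence\<close>

text \<open>An active constraint is kept by the sign of \<open>s\<close>, an inactive one by its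
  slack.\<close>

lemma eventually_perturbation_le:
  fixes c s b :: real
  assumes "c \<le> b" "c = b \<Longrightarrow> s \<le> 0"
  shows "\<forall>\<^sub>F \<epsilon> in at_right 0. c + \<epsilon> * s \<le> b"
proof (cases "c = b")
  case True
  have "\<forall>\<^sub>F \<epsilon> in at_right (0::real). 0 < \<epsilon>" by (rule eventually_at_right_less)
  then show ?thesis
    by eventually_elim (use True assms in \<open>auto simp: mult_le_0_iff\<close>)
next
  case False
  have "((\<lambda>\<epsilon>. c + \<epsilon> * s) \<longlongrightarrow> c + 0 * s) (at_right 0)" by (intro tendsto_intros)
  then have "\<forall>\<^sub>F \<epsilon> in at_right 0. c + \<epsilon> * s < b"
    by (rule order_tendstoD) (use False assms in auto)
  then show ?thesis by eventually_elim simp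
qed

context odd_cycle_graph
begin

lemma clp_feasible_cong:
  assumes "\<And>e. e \<in> E \<Longrightarrow> x e = x' e"
  shows "clp_feasible V E Cs x \<longleftrightarrow> clp_feasible V E Cs x'"
proof -
  have "(\<Sum>e\<in>{e\<in>E. i \<in> e}. x e) = (\<Sum>e\<in>{e\<in>E. i \<in> e}. x' e)" for i
    using assms by (intro sum.cong) auto
  moreover have "(\<Sum>e\<in>cyc_edges C. x e) = (\<Sum>e\<in>cyc_edges C. x' e)" if "C \<in> Cs" for C
    using assms cycle_subset(2)[OF that] by (intro sum.cong) auto
  ultimately show ?thesis unfolding clp_feasible_def using assms by simp
qed

lemma clp_feasible_matching:
  assumes M: "is_matching E M"
  shows "clp_feasible V E Cs (\<lambda>e. ind (e \<in> M))"
  unfolding clp_feasible_def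
proof (intro conjI ballI)
  fix i show "(\<Sum>e\<in>{e\<in>E. i \<in> e}. ind (e \<in> M)) \<le> 1"
    unfolding matching_degree[OF finite_E M] by (simp add: ind_def)
next
  fix C assume C: "C \<in> Cs"
  have "psi_c C (matching_assignment M) = 1"
    using feasible_matching_assignment[OF M] C unfolding feasible_def by blast
  then have "(\<Sum>j\<in>set C. ind (matching_assignment M (NewE C j))) \<le> real (length C) - 1"
    using odd_cycle.psi_c_eq_1_iff[OF odd_cycle[OF C]] odd_cycle.covers_sum_le[OF odd_cycle[OF C]] by blast
  moreover have "(\<Sum>e\<in>cyc_edges C. ind (e \<in> M)) = (\<Sum>e\<in>cyc_edges C. xmap (\<lambda>f. ind (matching_assignment M f)) e)"
    using cycle_subset(2)[OF C] by (intro sum.cong) (auto simp: xmap_matching_assignment[OF M])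
  ultimately show "(\<Sum>e\<in>cyc_edges C. ind (e \<in> M)) \<le> (real (length C) - 1) / 2"
    unfolding sum_cycle_xmap[OF C] by simp
qed (auto simp: ind_def)

lemma sum_ind_weight:
  assumes "M \<subseteq> E"
  shows "(\<Sum>e\<in>E. w e * ind (e \<in> M)) = sum w M"
proof -
  have "(\<Sum>e\<in>E. w e * ind (e \<in> M)) = (\<Sum>e\<in>E. if e \<in> M then w e else 0)"
    by (intro sum.cong) (auto simp: ind_def)
  then show ?thesis using assms finite_E by (simp add: sum.If_cases Int_absorb1)
qed

text \<open>The vertex constraints turn an integral solution into a matching. A feasible point with
  at least its weight is optimal as well, so uniqueness applies to it.\<close>

lemma unique_integral_opt_matching:
  assumes "clp_unique_integral_opt V E Cs w"
  obtains M where "is_matching E M"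
    "\<And>x. clp_feasible V E Cs x \<Longrightarrow> sum w M \<le> (\<Sum>e\<in>E. w e * x e) \<Longrightarrow> \<forall>e\<in>E. x e = ind (e \<in> M)"
proof -
  obtain x where opt: "clp_optimal V E Cs w x"
    and uniq: "\<And>x'. clp_optimal V E Cs w x' \<Longrightarrow> \<forall>e\<in>E. x' e = x e"
    and int: "\<And>e. e \<in> E \<Longrightarrow> x e \<in> {0, 1}"
    using assms unfolding clp_unique_integral_opt_def by blast
  define M where "M = {e\<in>E. x e = 1}"
  have x: "x e = ind (e \<in> M)" if "e \<in> E" for e
    using int that by (auto simp: M_def ind_def)
  have feas: "clp_feasible V E Cs (\<lambda>e. ind (e \<in> M))"
    using opt clp_feasible_cong[OF x] by (simp add: clp_optimal_def)
  have "is_matching E M"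
  proof (rule is_matching_if_degree_le_1[OF finite_E])
    fix j e assume "e \<in> M" "j \<in> e"
    then have "j \<in> V" using edge_subset by (auto simp: M_def)
    then show "(\<Sum>e\<in>{e\<in>E. j \<in> e}. ind (e \<in> M)) \<le> 1"
      using feas by (simp add: clp_feasible_def)
  qed (auto simp: M_def)
  moreover have "\<forall>e\<in>E. x' e = ind (e \<in> M)"
    if x': "clp_feasible V E Cs x'" "sum w M \<le> (\<Sum>e\<in>E. w e * x' e)" for x'
  proof -
    have "(\<Sum>e\<in>E. w e * x e) = (\<Sum>e\<in>E. w e * ind (e \<in> M))"
      using x by (intro sum.cong) auto
    also have "\<dots> = sum w M" by (rule sum_ind_weight) (auto simp: M_def)
    finally have "clp_optimal V E Cs w x'"
      using opt x' unfolding clp_optimal_def by (auto intro: order_trans)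
    then show ?thesis using uniq x by auto
  qed
  ultimately show thesis by (rule that)
qed

end

section \<open>The cone of the C-LP at its unique optimum\<close>

locale bp_unique_opt = bp_matching V E Cs w M
  for V :: "'v set" and E :: "'v set set" and Cs :: "'v list set" and w :: "'v set \<Rightarrow> real" and M :: "'v set set" +
  assumes unique_opt: "\<And>x. clp_feasible V E Cs x \<Longrightarrow> sum w M \<le> (\<Sum>e\<in>E. w e * x e) \<Longrightarrow>
    \<forall>e\<in>E. x e = ind (e \<in> M)"
begin

lemma is_max_weight_matching_iff: "is_max_weight_matching E w M' \<longleftrightarrow> M' = M"
proof -
  have le: "sum w N \<le> sum w M" and eq: "sum w M \<le> sum w N \<Longrightarrow> N = M" if N: "is_matching E N" for N
  proof -
    have sub: "N \<subseteq> E" "M \<subseteq> E" using N matching by (auto simp: is_matching_def)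
    show *: "N = M" if "sum w M \<le> sum w N"
    proof -
      have "\<forall>e\<in>E. ind (e \<in> N) = ind (e \<in> M)"
        using unique_opt[OF clp_feasible_matching[OF N]] that sub by (simp add: sum_ind_weight)
      then have "\<forall>e\<in>E. e \<in> N \<longleftrightarrow> e \<in> M" by (auto simp: ind_def split: if_splits)
      then show "N = M" using sub by blast
    qed
    show "sum w N \<le> sum w M" using * by (cases "sum w M \<le> sum w N") auto
  qed
  show ?thesis
    using le eq matching unfolding is_max_weight_matching_def by blast
qed

text \<open>The constraints of the C-LP that are active at the optimum, together with non-decrease of the
  objective. The upper bounds \<open>x e \<le> 1\<close> are left out because the vertex constraints imply them.\<close>

definition relaxed_cone :: "real \<Rightarrow> ('v set \<Rightarrow> real) \<Rightarrow> bool" where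
  "relaxed_cone c d \<longleftrightarrow>
     (\<forall>i\<in>V. (\<Sum>e\<in>{e\<in>E. i \<in> e}. ind (e \<in> M)) = 1 \<longrightarrow> (\<Sum>e\<in>{e\<in>E. i \<in> e}. d e) \<le> c) \<and>
     (\<forall>C\<in>Cs. (\<Sum>e\<in>cyc_edges C. ind (e \<in> M)) = (real (length C) - 1) / 2 \<longrightarrow> (\<Sum>e\<in>cyc_edges C. d e) \<le> c) \<and>
     (\<forall>e\<in>E - M. - d e \<le> c) \<and> - (\<Sum>e\<in>E. w e * d e) \<le> c"

text \<open>A small step from the optimum along \<open>d\<close> stays feasible without loss of
  objective, so uniqueness forces the step to be zero.\<close>

lemma relaxed_cone_0_trivial:
  assumes d: "relaxed_cone 0 d"
  shows "\<forall>e\<in>E. d e = 0"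
proof -
  let ?x = "\<lambda>e. ind (e \<in> M)"
  have x: "clp_feasible V E Cs ?x" by (rule clp_feasible_matching[OF matching])
  have "\<forall>\<^sub>F \<epsilon> in at_right 0. \<forall>i\<in>V. (\<Sum>e\<in>{e\<in>E. i \<in> e}. ?x e) + \<epsilon> * (\<Sum>e\<in>{e\<in>E. i \<in> e}. d e) \<le> 1"
    using x d unfolding clp_feasible_def relaxed_cone_def
    by (intro eventually_ball_finite finite_V ballI eventually_perturbation_le) auto
  moreover have "\<forall>\<^sub>F \<epsilon> in at_right 0. \<forall>C\<in>Cs. (\<Sum>e\<in>cyc_edges C. ?x e) + \<epsilon> * (\<Sum>e\<in>cyc_edges C. d e)
      \<le> (real (length C) - 1) / 2"
    using x d unfolding clp_feasible_def relaxed_cone_def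
    by (intro eventually_ball_finite finite_Cs ballI eventually_perturbation_le) auto
  moreover have "\<forall>\<^sub>F \<epsilon> in at_right 0. \<forall>e\<in>E. - ?x e + \<epsilon> * (- d e) \<le> 0"
    using x d unfolding clp_feasible_def relaxed_cone_def
    by (intro eventually_ball_finite finite_E ballI eventually_perturbation_le) (auto simp: ind_def split: if_splits)
  ultimately have "\<forall>\<^sub>F \<epsilon> in at_right 0. 0 < \<epsilon> \<and>
      (\<forall>i\<in>V. (\<Sum>e\<in>{e\<in>E. i \<in> e}. ?x e) + \<epsilon> * (\<Sum>e\<in>{e\<in>E. i \<in> e}. d e) \<le> 1) \<and>
      (\<forall>C\<in>Cs. (\<Sum>e\<in>cyc_edges C. ?x e) + \<epsilon> * (\<Sum>e\<in>cyc_edges C. d e) \<le> (real (length C) - 1) / 2) \<and>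
      (\<forall>e\<in>E. - ?x e + \<epsilon> * (- d e) \<le> 0)"
    using eventually_at_right_less[of "0::real"] by eventually_elim blast
  then have "\<exists>\<epsilon>. 0 < \<epsilon> \<and>
      (\<forall>i\<in>V. (\<Sum>e\<in>{e\<in>E. i \<in> e}. ?x e) + \<epsilon> * (\<Sum>e\<in>{e\<in>E. i \<in> e}. d e) \<le> 1) \<and>
      (\<forall>C\<in>Cs. (\<Sum>e\<in>cyc_edges C. ?x e) + \<epsilon> * (\<Sum>e\<in>cyc_edges C. d e) \<le> (real (length C) - 1) / 2) \<and>
      (\<forall>e\<in>E. - ?x e + \<epsilon> * (- d e) \<le> 0)"
    by (rule eventually_happens'[OF trivial_limit_at_right_real])
  then obtain \<epsilon> where \<epsilon>: "0 < \<epsilon>"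
    and V: "\<forall>i\<in>V. (\<Sum>e\<in>{e\<in>E. i \<in> e}. ?x e + \<epsilon> * d e) \<le> 1"
    and C: "\<forall>C\<in>Cs. (\<Sum>e\<in>cyc_edges C. ?x e + \<epsilon> * d e) \<le> (real (length C) - 1) / 2"
    and e: "\<forall>e\<in>E. - ?x e + \<epsilon> * (- d e) \<le> 0"
    unfolding sum.distrib sum_distrib_left by blast
  have nonneg: "\<forall>e\<in>E. 0 \<le> ?x e + \<epsilon> * d e" using e by auto
  have "?x e + \<epsilon> * d e \<le> 1" if e: "e \<in> E" for e
  proof -
    \<comment> \<open>The bound 1 on a single edge is recovered from the constraint of one of its
      endpoints.\<close>
    obtain i where i: "i \<in> e" using card_edge[OF e] by fastforce
    have "?x e + \<epsilon> * d e \<le> (\<Sum>e\<in>{e\<in>E. i \<in> e}. ?x e + \<epsilon> * d e)"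
      by (rule member_le_sum) (use e i nonneg finite_E in auto)
    also have "\<dots> \<le> 1" using V e i edge_subset by blast
    finally show ?thesis .
  qed
  then have "clp_feasible V E Cs (\<lambda>e. ?x e + \<epsilon> * d e)"
    using V C nonneg unfolding clp_feasible_def by blast
  moreover have "sum w M \<le> (\<Sum>e\<in>E. w e * (?x e + \<epsilon> * d e))"
  proof -
    have "(\<Sum>e\<in>E. w e * (?x e + \<epsilon> * d e)) = sum w M + \<epsilon> * (\<Sum>e\<in>E. w e * d e)"
      using matching sum_ind_weight[of M w]
      by (simp add: is_matching_def distrib_left sum.distrib sum_distrib_left mult_ac)
    moreover have "0 \<le> (\<Sum>e\<in>E. w e * d e)" using d unfolding relaxed_cone_def by simp
    ultimately show ?thesis using \<epsilon> by simp
  qed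
  ultimately show ?thesis using unique_opt \<epsilon> by fastforce
qed

lemma relaxed_cone_bounded: "\<exists>L. \<forall>d. relaxed_cone 2 d \<longrightarrow> (\<forall>e\<in>E. \<bar>d e\<bar> \<le> L)"
proof -
  \<comment> \<open>Each constraint is represented by its coefficient vector, so the index set
    consists of the rows themselves.\<close>
  define K where "K =
    (\<lambda>i e. ind (i \<in> e)) ` {i\<in>V. (\<Sum>e\<in>{e\<in>E. i \<in> e}. ind (e \<in> M)) = 1} \<union>
    (\<lambda>C e. ind (e \<in> cyc_edges C)) ` {C\<in>Cs. (\<Sum>e\<in>cyc_edges C. ind (e \<in> M)) = (real (length C) - 1) / 2} \<union>
    (\<lambda>e' e. - ind (e = e')) ` (E - M) \<union> {\<lambda>e. - w e}"
  have v: "(\<Sum>e\<in>E. ind (i \<in> e) * d e) = (\<Sum>e\<in>{e\<in>E. i \<in> e}. d e)" for i and d :: "'v set \<Rightarrow> real"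
    using finite_E by (auto simp: ind_def sum.inter_filter intro!: sum.cong)
  have cyc: "(\<Sum>e\<in>E. ind (e \<in> cyc_edges C) * d e) = (\<Sum>e\<in>cyc_edges C. d e)"
    if "C \<in> Cs" for C and d :: "'v set \<Rightarrow> real"
  proof -
    have "(\<Sum>e\<in>E. ind (e \<in> cyc_edges C) * d e) = (\<Sum>e\<in>E. if e \<in> cyc_edges C then d e else 0)"
      by (intro sum.cong) (auto simp: ind_def)
    then show ?thesis using cycle_subset(2)[OF that] finite_E by (simp add: sum.If_cases Int_absorb1)
  qed
  have sing: "(\<Sum>e\<in>E. ind (e = e') * d e) = d e'" if "e' \<in> E" for e' and d :: "'v set \<Rightarrow> real"
  proof -
    have "(\<Sum>e\<in>E. ind (e = e') * d e) = (\<Sum>e\<in>E. if e = e' then d e else 0)"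
      by (intro sum.cong) (auto simp: ind_def)
    then show ?thesis using that finite_E by simp
  qed
  have K: "(\<forall>k\<in>K. (\<Sum>e\<in>E. k e * d e) \<le> c) \<longleftrightarrow> relaxed_cone c d" for c d
    unfolding K_def relaxed_cone_def ball_Un ball_simps
    by (auto simp: v cyc sing sum_negf)
  have "\<exists>L. \<forall>d. (\<forall>k\<in>K. (\<Sum>e\<in>E. k e * d e) \<le> 2) \<longrightarrow> (\<forall>e\<in>E. \<bar>d e\<bar> \<le> L)"
  proof (rule trivial_cone_relaxation_bounded[OF finite_E])
    fix d assume "\<And>k. k \<in> K \<Longrightarrow> (\<Sum>e\<in>E. k e * d e) \<le> 0"
    then show "\<forall>e\<in>E. d e = 0" using relaxed_cone_0_trivial K[of d 0] by blast
  qed simp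
  then show ?thesis unfolding K .
qed

lemma tight_vertex:
  assumes "i \<in> V" "(\<Sum>e\<in>{e\<in>E. i \<in> e}. ind (e \<in> M)) = 1"
  shows "tight (FV i) (\<lambda>_. 1)"
proof -
  have "(\<Sum>f\<in>delta_v E Cs i. ind (ys f)) = (\<Sum>e\<in>{e\<in>E. i \<in> e}. ind (e \<in> M))"
    unfolding sum_delta_v ys_def by (intro sum.cong) (auto simp: xmap_matching_assignment[OF matching])
  then show ?thesis
    using assms unfolding tight_def factors_def fvars_def psi_fac_def psi_v_def
    by (auto simp: sum_subtractf split: if_splits)
qed

text \<open>Coefficient 1/2 because the sum of \<open>xmap\<close> over the cycle edges is half the
  sum over the new edges.\<close>

lemma tight_cycle:
  assumes C: "C \<in> Cs" "(\<Sum>e\<in>cyc_edges C. ind (e \<in> M)) = (real (length C) - 1) / 2"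
  shows "tight (FC C) (\<lambda>_. 1/2)"
proof -
  have "(\<Sum>e\<in>cyc_edges C. ind (e \<in> M)) = (\<Sum>e\<in>cyc_edges C. xmap (\<lambda>f. ind (ys f)) e)"
    unfolding ys_def using cycle_subset(2)[OF C(1)]
    by (intro sum.cong) (auto simp: xmap_matching_assignment[OF matching])
  then have "(\<Sum>f\<in>delta_c C. ind (ys f)) = real (length C) - 1"
    using C unfolding sum_delta_c sum_cycle_xmap[OF C(1)] by simp
  then show ?thesis
    using C unfolding tight_def factors_def fvars_def psi_fac_def psi_c_def
    by (auto simp: sum_subtractf sum_divide_distrib[symmetric] split: if_splits)
qed

text \<open>The linear form is minus the edge value of \<open>xmap\<close> at \<open>e\<close>: the
  factor makes that value 0 or 1, and at \<open>ys\<close> it is 0 since \<open>e\<close> is not in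
  \<open>M\<close>.\<close>

lemma tight_nonneg:
  assumes C: "C \<in> Cs" "e \<in> cyc_edges C" "e \<notin> M"
  shows "tight (FC C) (\<lambda>f. case f of OldE _ \<Rightarrow> 0 | NewE _ j \<Rightarrow> - 1/2 * (-1) ^ cyc_dist C j e)" (is "tight _ ?a")
proof -
  have a: "(\<Sum>f\<in>delta_c C. ?a f * ind (Y f)) = - (1/2 * (\<Sum>j\<in>set C. (-1) ^ cyc_dist C j e * ind (Y (NewE C j))))" for Y
    unfolding sum_delta_c by (simp add: sum_distrib_left sum_negf[symmetric])
  have "e \<in> E" using C cycle_subset by blast
  then have "(\<Sum>f\<in>delta_c C. ?a f * ind (ys f)) = 0"
    using xmap_matching_assignment[OF matching, of e] C(3)
    unfolding a ys_def xmap_cycle[OF C(1,2)] by (simp add: ind_def)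
  moreover have "(\<Sum>f\<in>delta_c C. ?a f * ind (Y f)) \<le> 0" if "psi_c C Y = 1" for Y
  proof -
    have "(\<Sum>j\<in>set C. (-1) ^ cyc_dist C j e * ind (Y (NewE C j))) \<in> {0, 2}"
      using that C(2) unfolding psi_c_def by (auto split: if_splits)
    then show ?thesis unfolding a by auto
  qed
  moreover have "\<bar>?a f\<bar> \<le> 1" for f by (simp add: abs_mult power_abs split: edge'.split)
  ultimately show ?thesis
    using C unfolding tight_def factors_def fvars_def psi_fac_def
    by (simp add: right_diff_distrib sum_subtractf)
qed

lemma relaxed_cone_xmap:
  assumes tight: "\<And>\<beta> a. tight \<beta> a \<Longrightarrow> (\<Sum>f\<in>fvars E Cs \<beta>. a f * d f) \<le> \<kappa>"
    and dir: "\<And>f. 0 \<le> dir f * d f" and \<kappa>: "0 \<le> \<kappa>" and w: "0 \<le> (\<Sum>f\<in>E' E Cs. w' w f * d f)"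
  shows "relaxed_cone \<kappa> (xmap d)"
  unfolding relaxed_cone_def
proof (intro conjI ballI impI)
  fix i assume "i \<in> V" "(\<Sum>e\<in>{e\<in>E. i \<in> e}. ind (e \<in> M)) = 1"
  then show "(\<Sum>e\<in>{e\<in>E. i \<in> e}. xmap d e) \<le> \<kappa>"
    using tight[OF tight_vertex] unfolding sum_delta_v[symmetric] by (simp add: fvars_def)
next
  fix C assume C: "C \<in> Cs" "(\<Sum>e\<in>cyc_edges C. ind (e \<in> M)) = (real (length C) - 1) / 2"
  then show "(\<Sum>e\<in>cyc_edges C. xmap d e) \<le> \<kappa>"
    using tight[OF tight_cycle] unfolding sum_cycle_xmap[OF C(1)]
    by (simp add: fvars_def sum_delta_c sum_divide_distrib)
next
  fix e assume e: "e \<in> E - M"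
  show "- xmap d e \<le> \<kappa>"
  proof (cases "e \<in> cyc_union Cs")
    case True
    then obtain C where C: "C \<in> Cs" "e \<in> cyc_edges C" by (auto simp: cyc_union_def)
    then show ?thesis
      using tight[OF tight_nonneg[OF C]] e unfolding xmap_cycle[OF C]
      by (simp add: fvars_def sum_delta_c sum_negf sum_divide_distrib)
  next
    case False
    \<comment> \<open>No single factor supplies this inequality; flips of an unselected edge only
      increase it, so \<open>d\<close> is nonnegative there.\<close>
    then have "\<not> ys (OldE e)"
      using e by (simp add: ys_def matching_assignment_def ymap_def)
    then show ?thesis using dir[of "OldE e"] \<kappa> False by (simp add: xmap_old dir_def ind_def)
  qed
next
  show "- (\<Sum>e\<in>E. w e * xmap d e) \<le> \<kappa>" using w \<kappa> unfolding sum_w' by simp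
qed

text \<open>By the inverse map \<open>ymap\<close>, each coordinate of \<open>d\<close> is a sum of
  distinct coordinates of \<open>xmap d\<close>; bounds on the cone thus carry over to
  walks.\<close>

lemma abs_le_sum_xmap:
  assumes f: "f \<in> E' E Cs"
  shows "\<bar>d f\<bar> \<le> (\<Sum>e\<in>E. \<bar>xmap d e\<bar>)"
proof (cases f)
  case (OldE e)
  then have e: "e \<in> E" "e \<notin> cyc_union Cs" using f by (auto simp: E'_def)
  have "\<bar>xmap d e\<bar> \<le> (\<Sum>e\<in>E. \<bar>xmap d e\<bar>)" by (rule member_le_sum) (use e finite_E in auto)
  then show ?thesis using OldE e by (simp add: xmap_old)
next
  case (NewE C j)
  then have C: "C \<in> Cs" using f by (auto simp: E'_def)
  have "d f = (\<Sum>e\<in>{e\<in>cyc_edges C. j \<in> e}. xmap d e)"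
    using ymap_xmap[OF f, of d] unfolding NewE ymap_def by simp
  then have "\<bar>d f\<bar> \<le> (\<Sum>e\<in>{e\<in>cyc_edges C. j \<in> e}. \<bar>xmap d e\<bar>)" by (simp add: sum_abs)
  also have "\<dots> \<le> (\<Sum>e\<in>E. \<bar>xmap d e\<bar>)"
    using cycle_subset(2)[OF C] finite_E by (intro sum_mono2) auto
  finally show ?thesis .
qed

lemma belief_pos: "0 < belief V E Cs w t e z"
  unfolding belief_def by (intro mult_pos_pos prod_pos) (auto simp: fmsg_pos)

lemma bp_est_eventually: "\<exists>T. \<forall>t\<ge>T. \<forall>e\<in>E' E Cs. bp_est V E Cs w t e = Some (ys e)"
proof -
  obtain L where L: "\<And>d e. relaxed_cone 2 d \<Longrightarrow> e \<in> E \<Longrightarrow> \<bar>d e\<bar> \<le> L"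
    using relaxed_cone_bounded by blast
  \<comment> \<open>Bounds the total length of a walk vector in the relaxed cone: every coordinate
    is at most \<open>card E * L\<close>. From time \<open>2 * n\<close> on, a walk that ran out of
    time is longer than this.\<close>
  define B where "B = real (card (E' E Cs)) * (real (card E) * L)"
  obtain n :: nat where n: "B < real n" using reals_Archimedean2 by blast
  have "bp_est V E Cs w t e = Some (ys e)" if t: "2 * n \<le> t" and e: "e \<in> E' E Cs" for t e
  proof -
    obtain d \<kappa> where
      diff: "ln (belief V E Cs w t e (\<not> ys e)) - ln (belief V E Cs w t e (ys e)) \<le> (\<Sum>f\<in>E' E Cs. w' w f * d f)"
      and dir: "\<And>f. 0 \<le> dir f * d f" and de: "d e \<noteq> 0"
      and \<kappa>: "\<kappa> = 0 \<or> \<kappa> \<le> 2 \<and> real (t div 2) \<le> (\<Sum>f\<in>E' E Cs. \<bar>d f\<bar>)"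
      and tight: "\<And>\<beta> a. tight \<beta> a \<Longrightarrow> (\<Sum>f\<in>fvars E Cs \<beta>. a f * d f) \<le> \<kappa>"
      using belief_bound[OF e, of t] by blast
    have "(\<Sum>f\<in>E' E Cs. w' w f * d f) < 0"
    proof (rule ccontr)
      assume "\<not> ?thesis"
      then have w: "0 \<le> (\<Sum>f\<in>E' E Cs. w' w f * d f)" by simp
      \<comment> \<open>Without error the direction lies in the exact cone and vanishes, against
        \<open>d e\<close> being nonzero; with error it lies in the relaxed cone, against its
        length.\<close>
      show False
      proof (cases "\<kappa> = 0")
        case True
        then have "relaxed_cone 0 (xmap d)" using tight dir w by (intro relaxed_cone_xmap) auto
        then have "\<forall>e\<in>E. xmap d e = 0" by (rule relaxed_cone_0_trivial)
        then have "\<bar>d e\<bar> \<le> 0" using abs_le_sum_xmap[OF e, of d] by simp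
        then show False using de by simp
      next
        case False
        then have "relaxed_cone 2 (xmap d)"
          using \<kappa> by (intro relaxed_cone_xmap dir w) (auto intro: order_trans[OF tight])
        then have "(\<Sum>e\<in>E. \<bar>xmap d e\<bar>) \<le> (\<Sum>e\<in>E. L)" by (intro sum_mono L)
        then have "\<bar>d f\<bar> \<le> real (card E) * L" if "f \<in> E' E Cs" for f
          using abs_le_sum_xmap[OF that, of d] by simp
        then have "(\<Sum>f\<in>E' E Cs. \<bar>d f\<bar>) \<le> (\<Sum>f\<in>E' E Cs. real (card E) * L)" by (rule sum_mono)
        also have "\<dots> < real n" using n by (simp add: B_def)
        also have "\<dots> \<le> real (t div 2)" using t by simp
        finally show False using \<kappa> False by simp
      qed
    qed
    then have "ln (belief V E Cs w t e (\<not> ys e)) < ln (belief V E Cs w t e (ys e))" using diff by linarith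
    then have "belief V E Cs w t e (\<not> ys e) < belief V E Cs w t e (ys e)"
      by (simp add: belief_pos)
    then show ?thesis unfolding bp_est_def by (cases "ys e") auto
  qed
  then show ?thesis by blast
qed

end

theorem theorem2:
  fixes V :: "'v set" and E :: "'v set set" and w :: "'v set \<Rightarrow> real"
    and Cs :: "'v list set"
  assumes "finite_graph V E"
    and "odd_cycle_collection V E Cs"
    and "clp_unique_integral_opt V E Cs w"
  shows "\<exists>ystar. is_MAP V E Cs w ystar \<and> (\<forall>y. is_MAP V E Cs w y \<longrightarrow> y = ystar) \<and>
           (\<exists>T. \<forall>t\<ge>T. \<forall>e\<in>E' E Cs. bp_est V E Cs w t e = Some (ystar e)) \<and>
           (\<exists>M. is_max_weight_matching E w M \<and>
                (\<forall>M'. is_max_weight_matching E w M' \<longrightarrow> M' = M) \<and>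
                (\<forall>e\<in>E. x_from_y Cs ystar e = (if e \<in> M then 1 else 0)))"
proof -
  interpret odd_cycle_graph V E Cs by unfold_locales fact+
  obtain M where M: "is_matching E M"
    "\<And>x. clp_feasible V E Cs x \<Longrightarrow> sum w M \<le> (\<Sum>e\<in>E. w e * x e) \<Longrightarrow> \<forall>e\<in>E. x e = ind (e \<in> M)"
    by (rule unique_integral_opt_matching[OF assms(3)]) blast
  interpret bp_unique_opt V E Cs w M by unfold_locales (use M in auto)
  have "x_from_y Cs ys e = (if e \<in> M then 1 else 0)" if "e \<in> E" for e
    using xmap_matching_assignment[OF matching that] by (simp add: x_from_y_eq ys_def ind_def)
  then show ?thesis
    using bp_est_eventually
    by (intro exI[of _ ys] conjI exI[of _ M]) (auto simp: is_MAP_iff is_max_weight_matching_iff ys_def)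
qed

end
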